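(* Let $n\ge 1$, $n<p<\infty$, and let $\rho$ be an admissible measure on $\mathbb{R}^n$. Suppose $S\in\mathcal{S}(n)$ and set $\mu=S_\#\rho$. If $u,v\in\mathcal{D}^{1,p}(\mathbb{R}^n)$ are extremals with $$[u]_\rho=\frac{\int_{\mathbb{R}^n}u(x)\,d\mu(x)}{\left|\int_{\mathbb{R}^n}x\,d\mu(x)\right|^{1-n/p}}>0\quad\text{and}\quad [v]_\rho=\frac{\int_{\mathbb{R}^n}v(y)\,d\rho(y)}{\left|\int_{\mathbb{R}^n}y\,d\rho(y)\right|^{1-n/p}}>0,$$ then $$v(y)=\frac{\int_{\mathbb{R}^n}v\,d\rho}{\int_{\mathbb{R}^n}u\,d\mu}\bigl(u(S(y))-u(S(0))\bigr)+v(0)$$ for all $y\in\mathbb{R}^n$.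
   Context: $\mathcal{D}^{1,p}(\mathbb{R}^n)$ is the space of $u\in L^1_{\rm loc}(\mathbb{R}^n)$ whose weak partial derivatives $u_{x_i}$, $i=1,\dots,n$, all belong to $L^p(\mathbb{R}^n)$. Since $p>n$, each $u$ is identified with its $(1-n/p)$-Hölder continuous representative. $\|Du\|_p:=\left(\int_{\mathbb{R}^n}|Du|^p\,dx\right)^{1/p}$. An admissible measure is a signed Borel measure $\rho$ on $\mathbb{R}^n$ with compact support, $\rho(\mathbb{R}^n)=0$, and $\int_{\mathbb{R}^n}y\,d\rho(y)\ne 0$. $\mathcal{S}(n)$ is the set of similarity transformations $S(y)=\lambda Oy+z$ of $\mathbb{R}^n$ with $\lambda>0$, $O\in\mathrm{O}(n)$, $z\in\mathbb{R}^n$. The push forward is $(S_\#\rho)(A)=\rho(S^{-1}(A))$ for Borel $A\subset\mathbb{R}^n$. For $u\in\mathcal{D}^{1,p}(\mathbb{R}^n)$, $$[u]_\rho:=\sup\left\{\frac{\left|\int u\,d\mu\right|}{\left|\int x\,d\mu(x)\right|^{1-n/p}}:\ \mu=S_\#\rho,\ S\in\mathcal{S}(n)\right\}.$$ $C_*$ is the smallest constant $C$ such that the generalized Morrey inequality $[u]_\rho\le C\|Du\|_p$ holds for all $u\in\mathcal{D}^{1,p}(\mathbb{R}^n)$. An extremal is a $u\in\mathcal{D}^{1,p}(\mathbb{R}^n)$ with $[u]_\rho=C_*\|Du\|_p$. *)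

theory Defs
  imports "HOL-Analysis.Analysis"
begin

subsection \<open>Test functions and weak derivatives\<close>

definition partial_deriv :: "'n \<Rightarrow> (real^'n \<Rightarrow> real) \<Rightarrow> real^'n \<Rightarrow> real" where
  "partial_deriv i f x = frechet_derivative f (at x) (axis i 1)"

primrec Ck :: "nat \<Rightarrow> (real^'n \<Rightarrow> real) \<Rightarrow> bool" where
  "Ck 0 f \<longleftrightarrow> continuous_on UNIV f"
| "Ck (Suc k) f \<longleftrightarrow> (\<forall>x. f differentiable (at x)) \<and> (\<forall>i. Ck k (partial_deriv i f))"

definition test_function :: "(real^'n \<Rightarrow> real) \<Rightarrow> bool" where
  "test_function \<phi> \<longleftrightarrow> (\<forall>k. Ck k \<phi>) \<and> compact (closure {x. \<phi> x \<noteq> 0})"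

definition L1_loc :: "(real^'n \<Rightarrow> real) set" where
  "L1_loc = {u \<in> borel_measurable borel. \<forall>K. compact K \<longrightarrow> set_integrable lborel K u}"

definition Lp :: "real \<Rightarrow> (real^'n \<Rightarrow> real) set" where
  "Lp p = {g \<in> borel_measurable borel. integrable lborel (\<lambda>x. \<bar>g x\<bar> powr p)}"

definition has_weak_partial :: "(real^'n \<Rightarrow> real) \<Rightarrow> 'n \<Rightarrow> (real^'n \<Rightarrow> real) \<Rightarrow> bool" where
  "has_weak_partial u i g \<longleftrightarrow> g \<in> L1_loc \<and>
     (\<forall>\<phi>. test_function \<phi> \<longrightarrow>
        (LINT x|lborel. u x * partial_deriv i \<phi> x) = - (LINT x|lborel. g x * \<phi> x))"

text \<open>Weak partial derivatives are determined only up to null sets; an arbitrary representative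
  is selected. Only integrals of it are used below.\<close>

definition weak_gradient :: "(real^'n \<Rightarrow> real) \<Rightarrow> real^'n \<Rightarrow> real^'n" where
  "weak_gradient u x = (\<chi> i. (SOME g. has_weak_partial u i g) x)"

definition norm_Du :: "real \<Rightarrow> (real^'n \<Rightarrow> real) \<Rightarrow> real" where
  "norm_Du p u = (LINT x|lborel. norm (weak_gradient u x) powr p) powr (1 / p)"

text \<open>For \<open>p > n\<close> every class of functions in the homogeneous Sobolev space has exactly one
  \<open>(1 - n/p)\<close>-Hoelder continuous representative. The space is taken to consist of these
  representatives, so that pointwise values and integrals against singular measures make
  sense.\<close>

definition holder_continuous :: "real \<Rightarrow> (real^'n \<Rightarrow> real) \<Rightarrow> bool" where
  "holder_continuous \<alpha> u \<longleftrightarrow> (\<exists>C. \<forall>x y. \<bar>u x - u y\<bar> \<le> C * norm (x - y) powr \<alpha>)"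

definition D1p :: "real \<Rightarrow> (real^'n \<Rightarrow> real) set" where
  "D1p p = {u \<in> L1_loc. (\<forall>i. \<exists>g \<in> Lp p. has_weak_partial u i g) \<and>
                        holder_continuous (1 - real CARD('n) / p) u}"


subsection \<open>Signed Borel measures\<close>

text \<open>A signed measure is a countably additive real-valued set function on the Borel sets; its
  values on other sets are irrelevant. Excluding infinite values loses nothing here: a signed
  measure whose value on the whole space is finite is finite on every Borel set.\<close>

definition signed_borel_measure :: "('a::topological_space set \<Rightarrow> real) \<Rightarrow> bool" where
  "signed_borel_measure \<rho> \<longleftrightarrow> \<rho> {} = 0 \<and>
     (\<forall>A :: nat \<Rightarrow> 'a set. range A \<subseteq> sets borel \<longrightarrow> disjoint_family A \<longrightarrow>
        (\<lambda>i. \<rho> (A i)) sums \<rho> (\<Union>i. A i))"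

text \<open>The upper variation of \<open>\<rho>\<close>, i.e. the positive part of its Jordan decomposition. The set
  \<open>B = {}\<close> contributes \<open>0\<close>, so the truncation of negative values by \<open>ennreal\<close> does not change
  the supremum.\<close>

definition upper_variation :: "('a::topological_space set \<Rightarrow> real) \<Rightarrow> 'a measure" where
  "upper_variation \<rho> =
     measure_of UNIV (sets borel) (\<lambda>A. SUP B \<in> {B \<in> sets borel. B \<subseteq> A}. ennreal (\<rho> B))"

definition lower_variation :: "('a::topological_space set \<Rightarrow> real) \<Rightarrow> 'a measure" where
  "lower_variation \<rho> = upper_variation (\<lambda>A. - \<rho> A)"

definition signed_integral ::
  "('a::topological_space set \<Rightarrow> real) \<Rightarrow> ('a \<Rightarrow> 'b::{banach, second_countable_topology}) \<Rightarrow> 'b"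
where
  "signed_integral \<rho> f = (LINT x|upper_variation \<rho>. f x) - (LINT x|lower_variation \<rho>. f x)"

definition signed_support :: "('a::topological_space set \<Rightarrow> real) \<Rightarrow> 'a set" where
  "signed_support \<rho> = - \<Union>{U. open U \<and> (\<forall>A \<in> sets borel. A \<subseteq> U \<longrightarrow> \<rho> A = 0)}"

definition push_forward :: "('a \<Rightarrow> 'b) \<Rightarrow> ('a set \<Rightarrow> real) \<Rightarrow> 'b set \<Rightarrow> real" where
  "push_forward S \<rho> A = \<rho> (S -` A)"

definition admissible :: "((real^'n) set \<Rightarrow> real) \<Rightarrow> bool" where
  "admissible \<rho> \<longleftrightarrow> signed_borel_measure \<rho> \<and> compact (signed_support \<rho>) \<and>
     \<rho> UNIV = 0 \<and> signed_integral \<rho> (\<lambda>y. y) \<noteq> 0"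


subsection \<open>The generalized Morrey inequality\<close>

definition similarities :: "(real^'n \<Rightarrow> real^'n) set" where
  "similarities = {S. \<exists>c Q z. c > 0 \<and> orthogonal_matrix Q \<and> S = (\<lambda>y. c *\<^sub>R (Q *v y) + z)}"

definition morrey_denominator :: "real \<Rightarrow> ((real^'n) set \<Rightarrow> real) \<Rightarrow> real" where
  "morrey_denominator p \<mu> = norm (signed_integral \<mu> (\<lambda>x. x)) powr (1 - real CARD('n) / p)"

definition morrey_seminorm ::
  "real \<Rightarrow> ((real^'n) set \<Rightarrow> real) \<Rightarrow> (real^'n \<Rightarrow> real) \<Rightarrow> ennreal"
where
  "morrey_seminorm p \<rho> u =
     (SUP \<mu> \<in> {push_forward S \<rho> |S. S \<in> similarities}.
        ennreal (\<bar>signed_integral \<mu> u\<bar> / morrey_denominator p \<mu>))"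

definition morrey_constant :: "real \<Rightarrow> ((real^'n) set \<Rightarrow> real) \<Rightarrow> ennreal" where
  "morrey_constant p \<rho> =
     Inf {C. \<forall>u \<in> D1p p. morrey_seminorm p \<rho> u \<le> C * ennreal (norm_Du p u)}"

definition extremal :: "real \<Rightarrow> ((real^'n) set \<Rightarrow> real) \<Rightarrow> (real^'n \<Rightarrow> real) \<Rightarrow> bool" where
  "extremal p \<rho> u \<longleftrightarrow>
     u \<in> D1p p \<and> morrey_seminorm p \<rho> u = morrey_constant p \<rho> * ennreal (norm_Du p u)"

end

theory Submission
  imports Defs
begin

text \<open>After rescaling, \<open>f = v / \<integral>v d\<rho>\<close> and \<open>g = (u \<circ> S) / \<integral>u d\<mu>\<close> both integrate to \<open>1\<close> against
  \<open>\<rho>\<close>, and the scaling behaviour of \<open>\<parallel>Du\<parallel>\<close> and of the denominators under similarities shows that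
  extremality of \<open>u\<close> and \<open>v\<close> forces \<open>\<parallel>Df\<parallel> = \<parallel>Dg\<parallel>\<close>, the least value that the Morrey inequality
  permits for a function with integral \<open>1\<close>. The midpoint \<open>(f + g) / 2\<close> has integral \<open>1\<close> too, so
  strict convexity of the \<open>L\<^sup>p\<close> norm gives \<open>Df = Dg\<close> almost everywhere, and \<open>f - g\<close> is constant.
  The Morrey constant is finite because it admits an extremal with finite positive seminorm.\<close>

subsection \<open>Smooth functions and the fundamental lemma of the calculus of variations\<close>

text \<open>The exponent \<open>1 - n/p\<close> is what makes the problem similarity invariant: for
  a similarity of ratio c, both the gradient norm of \<open>u \<circ> S\<close> and the denominator
  acquire the factor \<open>c powr (1 - n/p)\<close>, and total mass zero of \<rho> removes the
  translation. So the common norm of f and g is 1/(C d), with C the Morrey constant and d the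
  denominator of \<rho>. Three encodings shape the work. \<open>weak_gradient\<close> is an
  arbitrary choice, so every identity for it holds only almost everywhere and rests on uniqueness of
  weak derivatives; the way back to a pointwise statement is a constancy theorem for continuous
  functions, obtained by translating test functions rather than by mollifying. A signed measure is a
  bare set function whose variation is a supremum, so integrals against it become computable only
  through a Hahn decomposition. Finally, a function that is not integrable has integral 0, so a
  positive gradient norm already certifies the integrability that the convexity argument
  consumes.\<close>

lemma partial_deriv_eqI:
  "(f has_derivative f') (at x) \<Longrightarrow> partial_deriv i f x = f' (axis i 1)"
  unfolding partial_deriv_def by (metis frechet_derivative_at)

lemma Ck_SucI:
  assumes "\<And>x. f differentiable (at x)" "\<And>i. Ck k (partial_deriv i f)"
  shows "Ck (Suc k) f"
  using assms by simp

lemma Ck_Suc_differentiable: "Ck (Suc k) f \<Longrightarrow> f differentiable (at x)"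
  by simp

lemma Ck_Suc_partial_deriv: "Ck (Suc k) f \<Longrightarrow> Ck k (partial_deriv i f)"
  by simp

text \<open>At a successor level \<open>Ck\<close> asks for differentiability but says nothing about
  continuity of the function itself; the base case recovers it from differentiability.\<close>

lemma Ck_SucD: "Ck (Suc k) f \<Longrightarrow> Ck k f"
proof (induction k arbitrary: f)
  case 0
  then show ?case
    by (simp add: continuous_at_imp_continuous_on differentiable_imp_continuous_within)
next
  case (Suc k)
  from Suc.prems have "f differentiable (at x)" for x
    by (rule Ck_Suc_differentiable)
  moreover have "Ck k (partial_deriv i f)" for i
    by (rule Suc.IH, rule Ck_Suc_partial_deriv, rule Suc.prems)
  ultimately show ?case by (rule Ck_SucI)
qed

lemma Ck_const: "Ck k (\<lambda>x :: real^'n. c)"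
proof (induction k arbitrary: c)
  case (Suc k)
  have "partial_deriv i (\<lambda>x :: real^'n. c) = (\<lambda>x. 0)" for i
    by (rule ext, subst partial_deriv_eqI) (auto intro!: derivative_eq_intros)
  with Suc show ?case by (auto intro!: Ck_SucI)
qed simp

lemma partial_deriv_add:
  assumes "f differentiable (at x)" "g differentiable (at x)"
  shows "partial_deriv i (\<lambda>x. f x + g x) x = partial_deriv i f x + partial_deriv i g x"
  using assms[unfolded frechet_derivative_works]
  by (subst partial_deriv_eqI) (auto intro!: derivative_eq_intros simp: partial_deriv_def)

lemma partial_deriv_mult:
  assumes "f differentiable (at x)" "g differentiable (at x)"
  shows "partial_deriv i (\<lambda>x. f x * g x) x = f x * partial_deriv i g x + partial_deriv i f x * g x"
  using assms[unfolded frechet_derivative_works]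
  by (subst partial_deriv_eqI[OF has_derivative_mult]) (auto simp: partial_deriv_def)

lemma Ck_add: "Ck k f \<Longrightarrow> Ck k g \<Longrightarrow> Ck k (\<lambda>x. f x + g x)"
proof (induction k arbitrary: f g)
  case 0
  then show ?case by (simp add: continuous_on_add)
next
  case (Suc k)
  note d = Suc.prems[THEN Ck_Suc_differentiable]
  have "partial_deriv i (\<lambda>x. f x + g x) = (\<lambda>x. partial_deriv i f x + partial_deriv i g x)" for i
    using d by (intro ext partial_deriv_add)
  then show ?case
    using d Suc.IH Suc.prems[THEN Ck_Suc_partial_deriv] by (intro Ck_SucI) auto
qed

lemma Ck_mult: "Ck k f \<Longrightarrow> Ck k g \<Longrightarrow> Ck k (\<lambda>x. f x * g x)"
proof (induction k arbitrary: f g)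
  case 0
  then show ?case by (simp add: continuous_on_mult)
next
  case (Suc k)
  note d = Suc.prems[THEN Ck_Suc_differentiable]
  have eq: "partial_deriv i (\<lambda>x. f x * g x)
      = (\<lambda>x. f x * partial_deriv i g x + partial_deriv i f x * g x)" for i
    using d by (intro ext partial_deriv_mult)
  \<comment> \<open>The product rule leaves one factor undifferentiated in each term, so the factors
    are also needed at the lower level \<open>k\<close>.\<close>
  have "Ck k (partial_deriv i (\<lambda>x. f x * g x))" for i
    unfolding eq using Suc.prems[THEN Ck_SucD] Suc.prems[THEN Ck_Suc_partial_deriv]
    by (intro Ck_add Suc.IH)
  then show ?case
    using d by (intro Ck_SucI) auto
qed

lemma Ck_sum: "(\<And>i. i \<in> I \<Longrightarrow> Ck k (f i)) \<Longrightarrow> Ck k (\<lambda>x. \<Sum>i\<in>I. f i x)"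
  by (induction I rule: infinite_finite_induct) (auto intro: Ck_const Ck_add)

lemma Ck_prod: "(\<And>i. i \<in> I \<Longrightarrow> Ck k (f i)) \<Longrightarrow> Ck k (\<lambda>x. \<Prod>i\<in>I. f i x)"
  by (induction I rule: infinite_finite_induct) (auto intro: Ck_const Ck_mult)

lemma partial_deriv_affine:
  fixes A :: "real^'m^'n"
  assumes "f differentiable (at (A *v x + z))"
  shows "partial_deriv j (\<lambda>x. f (A *v x + z)) x
    = (\<Sum>i\<in>UNIV. A $ i $ j * partial_deriv i f (A *v x + z))"
proof -
  let ?f' = "frechet_derivative f (at (A *v x + z))"
  have f': "(f has_derivative ?f') (at (A *v x + z))"
    using assms by (simp add: frechet_derivative_works)
  have A: "((\<lambda>x. A *v x + z) has_derivative (\<lambda>h. A *v h)) (at x)"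
    by (intro has_derivative_add_const bounded_linear_imp_has_derivative
        matrix_vector_mul_bounded_linear)
  have "((\<lambda>x. f (A *v x + z)) has_derivative (\<lambda>h. ?f' (A *v h))) (at x)"
    by (rule has_derivative_compose[OF A f'])
  then have "partial_deriv j (\<lambda>x. f (A *v x + z)) x = ?f' (A *v axis j 1)"
    by (rule partial_deriv_eqI)
  also have "A *v axis j 1 = (\<Sum>i\<in>UNIV. (A $ i $ j) *\<^sub>R axis i 1)"
    using basis_expansion[of "column j A"]
    by (simp add: matrix_vector_mult_basis column_def scalar_mult_eq_scaleR)
  also have "?f' \<dots> = (\<Sum>i\<in>UNIV. A $ i $ j * ?f' (axis i 1))"
    using has_derivative_linear[OF f'] by (simp add: linear_sum linear_cmul)
  finally show ?thesis by (simp add: partial_deriv_def)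
qed

lemma differentiable_affine:
  fixes A :: "real^'m^'n" and f :: "real^'n \<Rightarrow> real"
  assumes "f differentiable (at (A *v x + z))"
  shows "(\<lambda>x. f (A *v x + z)) differentiable (at x)"
proof -
  have "(\<lambda>x. A *v x + z) differentiable (at x)"
    by (intro derivative_intros bounded_linear_imp_differentiable matrix_vector_mul_bounded_linear)
  then show ?thesis
    using assms differentiable_chain_at[of "\<lambda>x. A *v x + z" x f] by (simp add: o_def)
qed

lemma Ck_affine:
  fixes A :: "real^'m^'n"
  shows "Ck k f \<Longrightarrow> Ck k (\<lambda>x. f (A *v x + z))"
proof (induction k arbitrary: f)
  case 0
  then show ?case
    by (auto intro!: continuous_intros intro: continuous_on_compose2)
next
  case (Suc k)
  note d = Suc.prems[THEN Ck_Suc_differentiable]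
  have "partial_deriv j (\<lambda>x. f (A *v x + z))
      = (\<lambda>x. \<Sum>i\<in>UNIV. A $ i $ j * partial_deriv i f (A *v x + z))" for j
    by (intro ext partial_deriv_affine d)
  moreover have "Ck k (\<lambda>x. \<Sum>i\<in>UNIV. A $ i $ j * partial_deriv i f (A *v x + z))" for j
    using Suc.prems by (intro Ck_sum Ck_mult Ck_const Suc.IH) simp
  ultimately show ?case
    using d by (intro Ck_SucI differentiable_affine) auto
qed

text \<open>\<open>flat 0\<close> is the classical smooth function that vanishes on the negative
  axis. The powers of \<open>t\<close> in the denominator are added because the derivative of
  \<open>flat m\<close> is a combination of \<open>flat (m + 2)\<close> and
  \<open>flat (m + 1)\<close>: the family is closed under differentiation, so smoothness becomes an
  induction.\<close>

definition flat :: "nat \<Rightarrow> real \<Rightarrow> real" where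
  "flat m t = (if t > 0 then exp (- (1 / t)) / t ^ m else 0)"

lemma has_real_derivative_flat:
  "(flat m has_real_derivative flat (m + 2) t - m * flat (m + 1) t) (at t)"
proof -
  consider "t < 0" | "t = 0" | "t > 0" by linarith
  then show ?thesis
  proof cases
    case 1
    have "((\<lambda>t. 0) has_real_derivative 0) (at t)" by simp
    then have "(flat m has_real_derivative 0) (at t)"
      by (rule has_field_derivative_transform_within_open[of _ _ _ "{..<0}"])
        (use 1 in \<open>auto simp: flat_def\<close>)
    then show ?thesis using 1 by (simp add: flat_def)
  next
    case 3
    have "((\<lambda>t. exp (- (1 / t)) / t ^ m) has_real_derivative
        (exp (- (1 / t)) * (1 / t\<^sup>2) * t ^ m - exp (- (1 / t)) * (m * t ^ (m - 1))) / (t ^ m * t ^ m)) (at t)"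
      using 3 by (auto intro!: derivative_eq_intros simp: power2_eq_square)
    also have "(exp (- (1 / t)) * (1 / t\<^sup>2) * t ^ m - exp (- (1 / t)) * (m * t ^ (m - 1))) / (t ^ m * t ^ m)
        = flat (m + 2) t - m * flat (m + 1) t"
      \<comment> \<open>For \<open>m = 0\<close> the truncated exponent \<open>m - 1\<close> is
        harmless, as its term carries the factor \<open>m\<close>.\<close>
      using 3 by (cases m) (auto simp: flat_def field_simps power2_eq_square)
    finally show ?thesis
      by (rule has_field_derivative_transform_within_open[of _ _ _ "{0<..}"])
        (use 3 in \<open>auto simp: flat_def\<close>)
  next
    case 2
    \<comment> \<open>Replacing \<open>s\<close> by its inverse turns the difference quotient at 0
      into \<open>s ^ (m + 1) / exp s\<close> at infinity, where the exponential wins.\<close>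
    have "((\<lambda>s. flat m s / s) \<longlongrightarrow> 0) (at_right 0)"
      unfolding filterlim_at_right_to_top
    proof (rule Lim_transform_eventually)
      show "((\<lambda>s::real. s ^ (m + 1) / exp s) \<longlongrightarrow> 0) at_top"
        by (rule tendsto_power_div_exp_0)
      show "\<forall>\<^sub>F s in at_top. s ^ (m + 1) / exp s = flat m (inverse s) / inverse s"
        using eventually_gt_at_top[of "0::real"]
        by eventually_elim (auto simp: flat_def exp_minus field_simps)
    qed
    moreover have "((\<lambda>s. flat m s / s) \<longlongrightarrow> 0) (at_left 0)"
      by (rule Lim_transform_eventually[of "\<lambda>s. 0"])
        (auto simp: flat_def eventually_at_filter)
    ultimately have "((\<lambda>s. flat m s / s) \<longlongrightarrow> 0) (at 0)"
      by (simp add: filterlim_split_at)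
    then show ?thesis
      using 2 by (simp add: DERIV_def flat_def)
  qed
qed

text \<open>The induction must generalize over \<open>m\<close>, since each derivative raises it.
  The affine argument in one coordinate is the form in which the factors of \<open>box_bump\<close>
  occur.\<close>

lemma Ck_flat: "Ck k (\<lambda>x :: real^'n. flat m (c * x $ i + d))"
proof (induction k arbitrary: m)
  case 0
  have "continuous_on UNIV (flat m)"
    by (intro continuous_at_imp_continuous_on ballI DERIV_isCont[OF has_real_derivative_flat])
  then have "continuous_on UNIV (\<lambda>x :: real^'n. flat m (c * x $ i + d))"
    by (rule continuous_on_compose2) (auto intro!: continuous_intros)
  then show ?case by simp
next
  case (Suc k)
  let ?f = "\<lambda>m (x :: real^'n). flat m (c * x $ i + d)"
  have D: "(?f m has_derivative (\<lambda>h. (c * h $ i) * (?f (m + 2) x - m * ?f (m + 1) x))) (at x)" for x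
    by (rule DERIV_compose_FDERIV[OF has_real_derivative_flat])
      (auto intro!: derivative_eq_intros bounded_linear.has_derivative[OF bounded_linear_vec_nth])
  have "partial_deriv j (?f m)
      = (\<lambda>x. (c * axis j 1 $ i) * ?f (m + 2) x + (- (c * axis j 1 $ i) * m) * ?f (m + 1) x)" for j
    by (rule ext, subst partial_deriv_eqI[OF D]) (simp add: algebra_simps)
  moreover have "Ck k (\<lambda>x. (c * axis j 1 $ i) * ?f (m + 2) x + (- (c * axis j 1 $ i) * m) * ?f (m + 1) x)" for j
    by (intro Ck_add Ck_mult Ck_const Suc.IH)
  ultimately show ?case
    using D by (intro Ck_SucI) (auto simp: differentiable_def)
qed

text \<open>A smooth approximation of the indicator of \<open>box a b\<close>: each coordinate
  contributes a cutoff at either face, and \<open>k\<close> sharpens it, as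
  \<open>exp (- 1 / (k t))\<close> tends to 1 for every positive \<open>t\<close>.\<close>

definition box_bump :: "real^'n \<Rightarrow> real^'n \<Rightarrow> nat \<Rightarrow> real^'n \<Rightarrow> real" where
  "box_bump a b k x =
     (\<Prod>i\<in>UNIV. flat 0 (real k * (x $ i - a $ i)) * flat 0 (real k * (b $ i - x $ i)))"

lemma flat_0_bounds: "0 \<le> flat 0 t" "flat 0 t \<le> 1"
  by (auto simp: flat_def)

lemma box_bump_bounds: "0 \<le> box_bump a b k x" "box_bump a b k x \<le> 1"
  unfolding box_bump_def
  by (auto intro!: prod_nonneg prod_le_1 mult_nonneg_nonneg mult_le_one flat_0_bounds)

lemma box_bump_nonzero_imp:
  assumes "box_bump a b k x \<noteq> 0"
  shows "x \<in> box a b"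
proof -
  have "flat 0 (real k * (x $ i - a $ i)) \<noteq> 0 \<and> flat 0 (real k * (b $ i - x $ i)) \<noteq> 0" for i
    using assms by (auto simp: box_bump_def)
  then have "a $ i < x $ i \<and> x $ i < b $ i" for i
    by (force simp: flat_def zero_less_mult_iff split: if_splits)
  then show ?thesis by (simp add: mem_box_cart)
qed

lemma test_function_box_bump: "test_function (box_bump a b k)"
  unfolding test_function_def
proof
  have "Ck m (\<lambda>x. \<Prod>i\<in>UNIV. flat 0 (real k * x $ i + - (real k * a $ i))
      * flat 0 (- real k * x $ i + real k * b $ i))" for m
    by (intro Ck_prod Ck_mult Ck_flat)
  moreover have "(\<lambda>x. \<Prod>i\<in>UNIV. flat 0 (real k * x $ i + - (real k * a $ i))
      * flat 0 (- real k * x $ i + real k * b $ i)) = box_bump a b k"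
    by (simp add: box_bump_def fun_eq_iff algebra_simps)
  ultimately show "\<forall>m. Ck m (box_bump a b k)" by simp
  have "closure {x. box_bump a b k x \<noteq> 0} \<subseteq> cbox a b"
    using box_bump_nonzero_imp box_subset_cbox by (intro closure_minimal) blast+
  then show "compact (closure {x. box_bump a b k x \<noteq> 0})"
    using bounded_subset[OF bounded_cbox] by (auto simp: compact_eq_bounded_closed)
qed

lemma box_bump_tendsto:
  fixes x :: "real^'n"
  shows "(\<lambda>k. box_bump a b k x) \<longlonglongrightarrow> indicator (box a b) x"
proof (cases "x \<in> box a b")
  case True
  have *: "(\<lambda>k. flat 0 (real k * t)) \<longlonglongrightarrow> 1" if "t > 0" for t
  proof (rule Lim_transform_eventually)
    have "filterlim (\<lambda>k. real k * t) at_top sequentially"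
      using filterlim_tendsto_pos_mult_at_top[OF tendsto_const that filterlim_real_sequentially]
      by (simp add: mult.commute)
    then have "(\<lambda>k. exp (- inverse (real k * t))) \<longlonglongrightarrow> exp (- 0)"
      by (intro tendsto_exp tendsto_minus tendsto_inverse_0_at_top)
    then show "(\<lambda>k. exp (- inverse (real k * t))) \<longlonglongrightarrow> 1" by simp
    show "\<forall>\<^sub>F k in sequentially. exp (- inverse (real k * t)) = flat 0 (real k * t)"
      \<comment> \<open>At \<open>k = 0\<close> the two sides differ: \<open>inverse 0 = 0\<close>
        makes the exponential 1, while \<open>flat 0 0\<close> is 0.\<close>
      using eventually_gt_at_top[of "0::nat"]
      by (rule eventually_mono) (use that in \<open>auto simp: flat_def inverse_eq_divide\<close>)
  qed
  have "(\<lambda>k. box_bump a b k x) \<longlonglongrightarrow> (\<Prod>i\<in>(UNIV :: 'n set). 1 * 1)"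
    unfolding box_bump_def
    by (intro tendsto_prod tendsto_mult *) (use True in \<open>auto simp: mem_box_cart\<close>)
  then show ?thesis using True by simp
next
  case False
  then have "box_bump a b k x = 0" for k using box_bump_nonzero_imp by blast
  then show ?thesis using False by simp
qed

section \<open>Stability of test functions and integrability against them\<close>

lemma test_function_Ck: "test_function \<phi> \<Longrightarrow> Ck k \<phi>"
  by (simp add: test_function_def)

lemma test_function_differentiable: "test_function \<phi> \<Longrightarrow> \<phi> differentiable (at x)"
  by (meson Ck_Suc_differentiable test_function_Ck)

lemma test_function_continuous: "test_function \<phi> \<Longrightarrow> continuous_on UNIV \<phi>"
  using Ck.simps(1) test_function_Ck by blast

lemma test_function_partial_deriv:
  fixes \<phi> :: "real^'n \<Rightarrow> real"
  assumes "test_function \<phi>"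
  shows "test_function (partial_deriv i \<phi>)"
proof -
  let ?K = "closure {x. \<phi> x \<noteq> 0}"
  have "partial_deriv i \<phi> x = 0" if "x \<notin> ?K" for x
  proof -
    \<comment> \<open>Off its closed support \<phi> agrees with the zero function on an open set, so
      the derivatives agree there too.\<close>
    have "((\<lambda>x :: real^'n. 0 :: real) has_derivative (\<lambda>h. 0)) (at x)" by simp
    then have "(\<phi> has_derivative (\<lambda>h. 0)) (at x)"
      by (rule has_derivative_transform_within_open[where s = "- ?K"])
        (use that closure_subset[of "{x. \<phi> x \<noteq> 0}"] in auto)
    then show ?thesis by (rule partial_deriv_eqI)
  qed
  then have "closure {x. partial_deriv i \<phi> x \<noteq> 0} \<subseteq> ?K"
    by (intro closure_minimal) auto
  then have "compact (closure {x. partial_deriv i \<phi> x \<noteq> 0})"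
    using assms bounded_subset[of ?K] by (auto simp: compact_eq_bounded_closed test_function_def)
  then show ?thesis
    using assms unfolding test_function_def by (metis Ck_Suc_partial_deriv)
qed

lemma test_function_affine:
  fixes A :: "real^'n^'n"
  assumes "test_function \<phi>" "invertible A"
  shows "test_function (\<lambda>x. \<phi> (A *v x + z))"
  unfolding test_function_def
proof
  show "\<forall>k. Ck k (\<lambda>x. \<phi> (A *v x + z))"
    using assms(1) by (auto intro: Ck_affine test_function_Ck)
  obtain B where B: "B ** A = mat 1" using assms(2) by (auto simp: invertible_def)
  let ?K = "closure {x. \<phi> x \<noteq> 0}" and ?T = "\<lambda>y. B *v (y - z)"
  have "compact (?T ` ?K)"
    using assms(1)
    by (intro compact_continuous_image continuous_intros
        bounded_linear.continuous_on[OF matrix_vector_mul_bounded_linear])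
      (auto simp: test_function_def)
  moreover have "{x. \<phi> (A *v x + z) \<noteq> 0} \<subseteq> ?T ` ?K"
  proof
    fix x assume "x \<in> {x. \<phi> (A *v x + z) \<noteq> 0}"
    then have "A *v x + z \<in> ?K" using closure_subset[of "{x. \<phi> x \<noteq> 0}"] by auto
    moreover have "x = ?T (A *v x + z)"
      using B by (simp add: matrix_vector_mul_assoc)
    ultimately show "x \<in> ?T ` ?K" by blast
  qed
  ultimately show "compact (closure {x. \<phi> (A *v x + z) \<noteq> 0})"
    using bounded_subset[OF compact_imp_bounded] by (simp add: compact_closure)
qed

text \<open>A test function is bounded and lives on a compact set, so the product is dominated by a
  multiple of \<open>u\<close> restricted to that set. Whenever an integral against a test function
  is split below, this supplies the integrability that additivity requires.\<close>

lemma integrable_L1_loc_mult_test_function: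
  assumes u: "u \<in> L1_loc" and \<phi>: "test_function \<phi>"
  shows "integrable lborel (\<lambda>x. u x * \<phi> x)"
proof -
  let ?K = "closure {x. \<phi> x \<noteq> 0}"
  have K: "compact ?K" using \<phi> by (simp add: test_function_def)
  have cont: "continuous_on UNIV \<phi>" by (rule test_function_continuous[OF \<phi>])
  have [measurable]: "\<phi> \<in> borel_measurable borel" "u \<in> borel_measurable borel"
    using borel_measurable_continuous_onI[OF cont] u by (auto simp: L1_loc_def)
  have "compact (\<phi> ` ?K)"
    by (rule compact_continuous_image[OF continuous_on_subset[OF cont] K]) simp
  then obtain B where B: "\<And>x. x \<in> ?K \<Longrightarrow> \<bar>\<phi> x\<bar> \<le> B"
    by (meson bounded_real compact_imp_bounded imageI)
  have "integrable lborel (\<lambda>x. indicator ?K x *\<^sub>R u x)"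
    using u K by (simp add: L1_loc_def set_integrable_def)
  then have int: "integrable lborel (\<lambda>x. B * (indicator ?K x *\<^sub>R u x))"
    by (rule integrable_mult_right)
  show ?thesis
  proof (rule Bochner_Integration.integrable_bound[OF int])
    show "AE x in lborel. norm (u x * \<phi> x) \<le> norm (B * (indicator ?K x *\<^sub>R u x))"
    proof (rule AE_I2)
      fix x show "norm (u x * \<phi> x) \<le> norm (B * (indicator ?K x *\<^sub>R u x))"
      proof (cases "x \<in> ?K")
        case True
        then have "\<bar>\<phi> x\<bar> \<le> \<bar>B\<bar>" using B[of x] by linarith
        then show ?thesis using True
          by (simp add: abs_mult mult.commute mult_right_mono)
      next
        case False
        then have "\<phi> x = 0" using closure_subset[of "{x. \<phi> x \<noteq> 0}"] by auto
        then show ?thesis by simp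
      qed
    qed
  qed measurable
qed

text \<open>Since \<open>ennreal\<close> truncates at 0, \<open>?M\<close> and \<open>?N\<close>
  have the positive and the negative part of \<open>g\<close> as densities. They agree and are
  finite on open boxes, an intersection-stable generator of the Borel sets that contains an
  exhausting sequence, so they coincide. Uniqueness of densities equates the two parts of
  \<open>g\<close>, which forces \<open>g = 0\<close>.\<close>

lemma L1_loc_box_integrals_zero_imp_AE_zero:
  fixes g :: "real^'n \<Rightarrow> real"
  assumes g: "g \<in> L1_loc" and 0: "\<And>a b. (LINT x:box a b|lborel. g x) = 0"
  shows "AE x in lborel. g x = 0"
proof -
  have [measurable]: "g \<in> borel_measurable borel" using g by (simp add: L1_loc_def)
  let ?M = "density lborel (\<lambda>x. ennreal (g x))" and ?N = "density lborel (\<lambda>x. ennreal (- g x))"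
  have int: "integrable lborel (\<lambda>x. indicator (box a b) x * g x)" for a b
  proof -
    have "set_integrable lborel (cbox a b) g" using g by (simp add: L1_loc_def)
    then have "set_integrable lborel (box a b) g"
      by (rule set_integrable_subset) (auto simp: box_subset_cbox)
    then show ?thesis by (simp add: set_integrable_def)
  qed
  have pos: "emeasure ?M (box a b) = (\<integral>\<^sup>+x. ennreal (indicator (box a b) x * g x) \<partial>lborel)"
   and neg: "emeasure ?N (box a b) = (\<integral>\<^sup>+x. ennreal (- (indicator (box a b) x * g x)) \<partial>lborel)" for a b
    by (auto simp: emeasure_density intro!: nn_integral_cong split: split_indicator)
  have fin: "emeasure ?M (box a b) \<noteq> \<infinity>" "emeasure ?N (box a b) \<noteq> \<infinity>" for a b
    unfolding pos neg using real_integrable_def[THEN iffD1, OF int[of a b]] by auto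
  have eq: "emeasure ?M (box a b) = emeasure ?N (box a b)" for a b
  proof -
    have "(LINT x|lborel. indicator (box a b) x * g x) = 0"
      using 0[of a b] by (simp add: set_lebesgue_integral_def)
    then have "enn2real (emeasure ?M (box a b)) = enn2real (emeasure ?N (box a b))"
      unfolding pos neg real_lebesgue_integral_def[OF int[of a b]] by simp
    with fin[of a b] show ?thesis
      by (metis ennreal_enn2real infinity_ennreal_def less_top)
  qed
  have "?M = ?N"
  proof (rule measure_eqI_generator_eq)
    let ?E = "range (\<lambda>(a, b). box a b :: (real^'n) set)"
    show "Int_stable ?E"
      by (auto simp: Int_stable_def box_Int_box)
    show "range (\<lambda>n::nat. box (- (real n *\<^sub>R One)) (real n *\<^sub>R One)) \<subseteq> ?E" by auto
    show "(\<Union>n::nat. box (- (real n *\<^sub>R One)) (real n *\<^sub>R One)) = (UNIV :: (real^'n) set)"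
      by (rule UN_box_eq_UNIV)
    show "sets ?M = sigma_sets UNIV ?E" "sets ?N = sigma_sets UNIV ?E"
      by (simp_all add: borel_eq_box)
  qed (use eq fin in auto)
  then have "AE x in lborel. ennreal (g x) = ennreal (- g x)"
    by (subst (asm) sigma_finite_measure.density_unique_iff[OF sigma_finite_lborel]) auto
  then show ?thesis
  proof eventually_elim
    case (elim x)
    then show "g x = 0"
      by (cases "g x" "0::real" rule: linorder_cases) (auto simp: ennreal_neg ennreal_eq_0_iff)
  qed
qed

text \<open>Testing with box bumps suffices: they converge to the indicator of the open box and are
  dominated by that of the closed box, so dominated convergence carries the vanishing integrals over
  to boxes.\<close>

lemma fundamental_lemma_calculus_of_variations:
  fixes g :: "real^'n \<Rightarrow> real"
  assumes g: "g \<in> L1_loc" and 0: "\<And>\<phi>. test_function \<phi> \<Longrightarrow> (LINT x|lborel. g x * \<phi> x) = 0"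
  shows "AE x in lborel. g x = 0"
proof (rule L1_loc_box_integrals_zero_imp_AE_zero[OF g])
  fix a b :: "real^'n"
  have [measurable]: "g \<in> borel_measurable borel" using g by (simp add: L1_loc_def)
  have [measurable]: "box_bump a b k \<in> borel_measurable borel" for k
    by (rule borel_measurable_continuous_onI, rule test_function_continuous, rule test_function_box_bump)
  have "set_integrable lborel (cbox a b) g" using g by (simp add: L1_loc_def)
  then have int: "integrable lborel (\<lambda>x. norm (indicator (cbox a b) x * g x))"
    unfolding set_integrable_def by (intro integrable_norm) simp
  have "(\<lambda>k. LINT x|lborel. g x * box_bump a b k x) \<longlonglongrightarrow> (LINT x|lborel. g x * indicator (box a b) x)"
  proof (rule integral_dominated_convergence[OF _ _ int])
    show "AE x in lborel. (\<lambda>k. g x * box_bump a b k x) \<longlonglongrightarrow> g x * indicator (box a b) x"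
      by (intro AE_I2 tendsto_intros box_bump_tendsto)
    show "AE x in lborel. norm (g x * box_bump a b k x) \<le> norm (indicator (cbox a b) x * g x)" for k
    proof (rule AE_I2)
      fix x
      show "norm (g x * box_bump a b k x) \<le> norm (indicator (cbox a b) x * g x)"
      proof (cases "box_bump a b k x = 0")
        case False
        then have "x \<in> cbox a b"
          using box_bump_nonzero_imp[of a b k x] box_subset_cbox[of a b] by blast
        then show ?thesis
          using box_bump_bounds[of a b k x] by (simp add: abs_mult mult_left_le)
      qed simp
    qed
  qed measurable
  moreover have "(LINT x|lborel. g x * box_bump a b k x) = 0" for k
    by (rule 0[OF test_function_box_bump])
  ultimately have "(\<lambda>k :: nat. 0 :: real) \<longlonglongrightarrow> (LINT x|lborel. g x * indicator (box a b) x)"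
    by simp
  then have "(LINT x|lborel. g x * indicator (box a b) x) = 0"
    by (simp add: LIMSEQ_const_iff)
  then show "(LINT x:box a b|lborel. g x) = 0"
    by (simp add: set_lebesgue_integral_def mult.commute)
qed


subsection \<open>Hahn decomposition and integration against signed measures\<close>

lemma signed_borel_measure_empty: "signed_borel_measure \<rho> \<Longrightarrow> \<rho> {} = 0"
  by (simp add: signed_borel_measure_def)

lemma signed_borel_measure_sums:
  assumes "signed_borel_measure \<rho>" "\<And>i :: nat. A i \<in> sets borel" "disjoint_family A"
  shows "(\<lambda>i. \<rho> (A i)) sums \<rho> (\<Union>i. A i)"
  using assms unfolding signed_borel_measure_def by blast

lemma signed_borel_measure_Un:
  assumes \<rho>: "signed_borel_measure \<rho>" and "A \<in> sets borel" "B \<in> sets borel" "A \<inter> B = {}"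
  shows "\<rho> (A \<union> B) = \<rho> A + \<rho> B"
proof -
  have "(\<lambda>i. \<rho> (binaryset A B i)) sums \<rho> (\<Union>i. binaryset A B i)"
    using assms by (intro signed_borel_measure_sums)
      (auto simp: binaryset_def disjoint_family_on_def)
  moreover have "(\<lambda>i. \<rho> (binaryset A B i)) sums (\<rho> A + \<rho> B)"
    by (rule binaryset_sums) (rule signed_borel_measure_empty[OF \<rho>])
  ultimately show ?thesis
    using sums_unique2 by (force simp: UN_binaryset_eq)
qed

lemma signed_borel_measure_split:
  assumes "signed_borel_measure \<rho>" and "A \<in> sets borel" "P \<in> sets borel"
  shows "\<rho> A = \<rho> (A \<inter> P) + \<rho> (A - P)"
  using signed_borel_measure_Un[of \<rho> "A \<inter> P" "A - P"] assms
  by (simp add: Int_Diff_disjoint Int_Diff_Un)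

lemma signed_borel_measure_Diff:
  assumes "signed_borel_measure \<rho>" and "A \<in> sets borel" "B \<in> sets borel" "B \<subseteq> A"
  shows "\<rho> (A - B) = \<rho> A - \<rho> B"
  using signed_borel_measure_split[of \<rho> A B] assms by (simp add: Int_absorb1)

lemma signed_borel_measure_uminus:
  "signed_borel_measure \<rho> \<Longrightarrow> signed_borel_measure (\<lambda>A. - \<rho> A)"
  by (auto simp: signed_borel_measure_def intro: sums_minus)

definition positive_set :: "('a::topological_space set \<Rightarrow> real) \<Rightarrow> 'a set \<Rightarrow> bool" where
  "positive_set \<rho> P \<longleftrightarrow> P \<in> sets borel \<and> (\<forall>B\<in>sets borel. B \<subseteq> P \<longrightarrow> 0 \<le> \<rho> B)"

text \<open>Disjointifying the union cuts a Borel subset into countably many pieces, each inside a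
  single \<open>P n\<close> and hence of nonnegative measure.\<close>

lemma positive_set_UN:
  assumes \<rho>: "signed_borel_measure \<rho>" and P: "\<And>n :: nat. positive_set \<rho> (P n)"
  shows "positive_set \<rho> (\<Union>n. P n)"
  unfolding positive_set_def
proof safe
  have Pm [measurable]: "P n \<in> sets borel" for n using P by (simp add: positive_set_def)
  show "(\<Union>n. P n) \<in> sets borel" by measurable
  fix B assume [measurable]: "B \<in> sets borel" and B: "B \<subseteq> (\<Union>n. P n)"
  have dm: "disjointed P n \<in> sets borel" for n
    using sets.range_disjointed_sets[of P borel] Pm by blast
  have s: "(\<lambda>n. \<rho> (B \<inter> disjointed P n)) sums \<rho> (\<Union>n. B \<inter> disjointed P n)"
    using disjoint_family_disjointed[of P] dm
    by (intro signed_borel_measure_sums[OF \<rho>]) (auto simp: disjoint_family_on_def)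
  have "0 \<le> \<rho> (B \<inter> disjointed P n)" for n
    using P[of n] disjointed_subset[of P n] dm[of n] unfolding positive_set_def
    by (meson inf.coboundedI2 sets.Int \<open>B \<in> sets borel\<close>)
  from sums_le[OF this sums_zero s] have "0 \<le> \<rho> (\<Union>n. B \<inter> disjointed P n)" .
  moreover have "(\<Union>n. B \<inter> disjointed P n) = B"
    using B UN_disjointed_eq[of P] by auto
  ultimately show "0 \<le> \<rho> B" by simp
qed

lemma positive_set_mono:
  assumes \<rho>: "signed_borel_measure \<rho>" and "positive_set \<rho> Q" "P \<in> sets borel" "P \<subseteq> Q"
  shows "\<rho> P \<le> \<rho> Q"
proof -
  have "0 \<le> \<rho> (Q - P)" using assms unfolding positive_set_def by blast
  then show ?thesis
    using signed_borel_measure_Diff[OF \<rho>, of Q P] assms by (simp add: positive_set_def)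
qed

text \<open>The bound \<open>-1\<close> takes care of the case where \<open>\<rho>\<close> is not known to be bounded below.\<close>

lemma exists_almost_least_subset:
  assumes \<rho>: "signed_borel_measure \<rho>"
  shows "\<exists>B\<in>sets borel. B \<subseteq> X \<and> \<rho> B \<le> 0 \<and>
    (\<forall>C\<in>sets borel. C \<subseteq> X \<longrightarrow> \<rho> B \<le> max (- 1) (\<rho> C / 2))"
proof -
  let ?V = "\<rho> ` {C \<in> sets borel. C \<subseteq> X}"
  have 0: "0 \<in> ?V" using signed_borel_measure_empty[OF \<rho>] by (auto intro!: image_eqI[of _ _ "{}"])
  show ?thesis
  proof (cases "\<exists>C\<in>sets borel. C \<subseteq> X \<and> \<rho> C \<le> - 1")
    case True
    then obtain C where "C \<in> sets borel" "C \<subseteq> X" "\<rho> C \<le> - 1" by blast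
    then show ?thesis by (intro bexI[of _ C]) auto
  next
    case False
    then have lower: "- 1 \<le> \<rho> C" if "C \<in> sets borel" "C \<subseteq> X" for C
      using that by (meson linear)
    have bounded: "bdd_below ?V"
      by (rule bdd_belowI[of _ "- 1"]) (auto intro: lower)
    show ?thesis
    proof (cases "Inf ?V = 0")
      case True
      then have "0 \<le> \<rho> C" if "C \<in> sets borel" "C \<subseteq> X" for C
        using cInf_lower[OF _ bounded, of "\<rho> C"] that by auto
      then show ?thesis
        using signed_borel_measure_empty[OF \<rho>] by (intro bexI[of _ "{}"]) (auto simp: le_max_iff_disj)
    next
      case False
      then have neg: "Inf ?V < 0" using cInf_lower[OF 0 bounded] by simp
      \<comment> \<open>A negative infimum lies strictly below its own half, so some value falls
        below that half.\<close>
      then obtain B where B: "B \<in> sets borel" "B \<subseteq> X" "\<rho> B < Inf ?V / 2"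
        using cInf_lessD[of ?V "Inf ?V / 2"] 0 by auto
      have "\<rho> B \<le> \<rho> C / 2" if "C \<in> sets borel" "C \<subseteq> X" for C
        using cInf_lower[OF _ bounded, of "\<rho> C"] that B(3) by fastforce
      then show ?thesis using B neg by (intro bexI[of _ B]) (auto simp: le_max_iff_disj)
    qed
  qed
qed

text \<open>Greedy removal: cut an almost least subset out of what remains, again and again. The
  removed pieces have nonpositive measure, so what is left has at least the measure of
  \<open>A\<close>. They are disjoint, so their measures are summable and tend to 0; but a subset
  \<open>C\<close> of the remainder was a competitor at every stage, whence
  \<open>0 \<le> max (- 1) (\<rho> C / 2)\<close> in the limit.\<close>

lemma exists_positive_subset:
  assumes \<rho>: "signed_borel_measure \<rho>" and A: "A \<in> sets borel"
  shows "\<exists>P. P \<subseteq> A \<and> positive_set \<rho> P \<and> \<rho> A \<le> \<rho> P"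
proof -
  obtain b where b: "\<And>X. b X \<in> sets borel" "\<And>X. b X \<subseteq> X" "\<And>X. \<rho> (b X) \<le> 0"
    "\<And>X C. C \<in> sets borel \<Longrightarrow> C \<subseteq> X \<Longrightarrow> \<rho> (b X) \<le> max (- 1) (\<rho> C / 2)"
    using exists_almost_least_subset[OF \<rho>] by metis
  define X where "X n = ((\<lambda>X. X - b X) ^^ n) A" for n
  have X_Suc: "X (Suc n) = X n - b (X n)" and X_0: "X 0 = A" for n by (simp_all add: X_def)
  have anti: "X n \<subseteq> X m" if "m \<le> n" for m n
    using that by (induction rule: dec_induct) (auto simp: X_Suc)
  have disj: "b (X m) \<inter> b (X n) = {}" if "m < n" for m n
    using anti[of "Suc m" n] that b(2)[of "X n"] by (auto simp: X_Suc)
  have "disjoint_family (\<lambda>n. b (X n))"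
    unfolding disjoint_family_on_def using disj by (metis inf_commute linorder_neqE_nat)
  then have sums: "(\<lambda>n. \<rho> (b (X n))) sums \<rho> (\<Union>n. b (X n))"
    by (intro signed_borel_measure_sums[OF \<rho>] b)
  define P where "P = A - (\<Union>n. b (X n))"
  have [measurable]: "(\<Union>n. b (X n)) \<in> sets borel" using b(1) by blast
  have sub: "P \<subseteq> X n" for n
    by (induction n) (auto simp: X_0 X_Suc P_def)
  have "\<rho> (\<Union>n. b (X n)) \<le> 0"
    by (rule sums_le[OF b(3) sums sums_zero])
  moreover have "(\<Union>n. b (X n)) \<subseteq> A"
    using b(2) anti[of 0] X_0 by blast
  ultimately have "\<rho> A \<le> \<rho> P"
    using signed_borel_measure_Diff[OF \<rho> A, of "\<Union>n. b (X n)"] by (simp add: P_def)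
  moreover have "positive_set \<rho> P"
    unfolding positive_set_def
  proof safe
    show "P \<in> sets borel" using A by (simp add: P_def)
    fix C assume C: "C \<in> sets borel" "C \<subseteq> P"
    have "(\<lambda>n. \<rho> (b (X n))) \<longlonglongrightarrow> 0"
      using sums by (intro summable_LIMSEQ_zero sums_summable)
    then have "0 \<le> max (- 1) (\<rho> C / 2)"
      by (rule LIMSEQ_le_const2) (use C sub b(4) in blast)
    then show "0 \<le> \<rho> C" by simp
  qed
  ultimately show ?thesis unfolding P_def by blast
qed

definition hahn_set :: "('a::topological_space set \<Rightarrow> real) \<Rightarrow> 'a set \<Rightarrow> bool" where
  "hahn_set \<rho> P \<longleftrightarrow> positive_set \<rho> P \<and> positive_set (\<lambda>A. - \<rho> A) (- P)"

lemma hahn_set_borel: "hahn_set \<rho> P \<Longrightarrow> P \<in> sets borel"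
  by (simp add: hahn_set_def positive_set_def)

lemma hahn_set_nonneg: "hahn_set \<rho> P \<Longrightarrow> B \<in> sets borel \<Longrightarrow> B \<subseteq> P \<Longrightarrow> 0 \<le> \<rho> B"
  by (simp add: hahn_set_def positive_set_def)

lemma hahn_set_nonpos: "hahn_set \<rho> P \<Longrightarrow> B \<in> sets borel \<Longrightarrow> B \<inter> P = {} \<Longrightarrow> \<rho> B \<le> 0"
  by (simp add: hahn_set_def positive_set_def disjoint_eq_subset_Compl)

lemma hahn_set_uminus: "hahn_set \<rho> P \<Longrightarrow> hahn_set (\<lambda>A. - \<rho> A) (- P)"
  by (simp add: hahn_set_def)

text \<open>The union of a sequence of positive sets is positive and at least as large as each of
  them. This fact, \<open>sup\<close>, serves twice: with bounds \<open>real n\<close> it excludes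
  an infinite supremum, because the union has a real measure; with bounds approaching the supremum
  it shows that the supremum is attained.\<close>

lemma exists_largest_positive_set:
  assumes \<rho>: "signed_borel_measure \<rho>"
  shows "\<exists>P. positive_set \<rho> P \<and> (\<forall>Q. positive_set \<rho> Q \<longrightarrow> \<rho> Q \<le> \<rho> P)"
proof -
  let ?V = "\<rho> ` Collect (positive_set \<rho>)"
  have sup: "\<exists>P. positive_set \<rho> P \<and> (\<forall>n. f n \<le> \<rho> P)"
    if ex: "\<And>n. \<exists>Q. positive_set \<rho> Q \<and> f n \<le> \<rho> Q" for f :: "nat \<Rightarrow> real"
  proof -
    obtain Q where Q: "\<And>n. positive_set \<rho> (Q n)" "\<And>n. f n \<le> \<rho> (Q n)" using ex by metis
    have pos: "positive_set \<rho> (\<Union>n. Q n)" by (rule positive_set_UN[OF \<rho> Q(1)])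
    have "f n \<le> \<rho> (\<Union>n. Q n)" for n
      using positive_set_mono[OF \<rho> pos, of "Q n"] Q[of n] UN_upper[of n UNIV Q]
      by (simp add: positive_set_def)
    with pos show ?thesis by blast
  qed
  have bdd: "bdd_above ?V"
  proof (rule ccontr)
    assume nb: "\<not> bdd_above ?V"
    have "\<exists>Q. positive_set \<rho> Q \<and> real n \<le> \<rho> Q" for n
      using nb unfolding bdd_above_def by (auto simp: not_le intro: less_imp_le)
    then obtain P where "\<And>n. real n \<le> \<rho> P" using sup[of real] by blast
    then show False using reals_Archimedean2 by (meson not_le)
  qed
  have "positive_set \<rho> {}"
    using signed_borel_measure_empty[OF \<rho>] by (simp add: positive_set_def)
  then have ne: "?V \<noteq> {}" by blast
  have "\<exists>Q. positive_set \<rho> Q \<and> Sup ?V - 1 / Suc n \<le> \<rho> Q" for n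
    using less_cSupD[OF ne, of "Sup ?V - 1 / Suc n"] by force
  then obtain P where P: "positive_set \<rho> P" "\<And>n. Sup ?V - 1 / Suc n \<le> \<rho> P"
    using sup[of "\<lambda>n. Sup ?V - 1 / Suc n"] by blast
  have "(\<lambda>n. Sup ?V - 1 / Suc n) \<longlonglongrightarrow> Sup ?V - 0"
    by (intro tendsto_diff tendsto_const LIMSEQ_Suc[OF lim_1_over_n])
  then have "Sup ?V \<le> \<rho> P"
    using P(2) by (intro LIMSEQ_le_const2[where X = "\<lambda>n. Sup ?V - 1 / Suc n"]) auto
  then have "\<rho> Q \<le> \<rho> P" if "positive_set \<rho> Q" for Q
    using cSup_upper[OF _ bdd, of "\<rho> Q"] that by fastforce
  with P(1) show ?thesis by blast
qed

text \<open>A set of positive measure outside a largest positive set would contain a positive set of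
  positive measure, and adjoining that would enlarge the largest one.\<close>

lemma Hahn_decomposition:
  assumes \<rho>: "signed_borel_measure \<rho>"
  shows "\<exists>P. hahn_set \<rho> P"
proof -
  obtain P where P: "positive_set \<rho> P" "\<And>Q. positive_set \<rho> Q \<Longrightarrow> \<rho> Q \<le> \<rho> P"
    using exists_largest_positive_set[OF \<rho>] by blast
  have [measurable]: "P \<in> sets borel" using P(1) by (simp add: positive_set_def)
  have "\<rho> B \<le> 0" if B: "B \<in> sets borel" "B \<subseteq> - P" for B
  proof -
    obtain Q where Q: "Q \<subseteq> B" "positive_set \<rho> Q" "\<rho> B \<le> \<rho> Q"
      using exists_positive_subset[OF \<rho> B(1)] by blast
    \<comment> \<open>The union of two sets is written as a countable one so that
      \<open>positive_set_UN\<close> applies.\<close>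
    have "positive_set \<rho> (\<Union>n. if n = (0::nat) then P else Q)"
      using P(1) Q(2) by (intro positive_set_UN[OF \<rho>]) auto
    also have "(\<Union>n. if n = (0::nat) then P else Q) = P \<union> Q"
      by (auto split: if_splits)
    finally have "\<rho> (P \<union> Q) \<le> \<rho> P" by (rule P(2))
    moreover have "\<rho> (P \<union> Q) = \<rho> P + \<rho> Q"
      using Q B by (intro signed_borel_measure_Un[OF \<rho>]) (auto simp: positive_set_def)
    ultimately show ?thesis using Q(3) by simp
  qed
  then show ?thesis
    using P(1) by (intro exI[of _ P]) (auto simp: hahn_set_def positive_set_def)
qed

section \<open>Variation measures and integrals against signed measures\<close>

lemma sets_upper_variation [simp, measurable_cong]: "sets (upper_variation \<rho>) = sets borel"
  unfolding upper_variation_def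
  by (subst sets_measure_of) (auto simp: sets.sigma_sets_eq[of borel, simplified])

lemma space_upper_variation [simp]: "space (upper_variation \<rho>) = UNIV"
  unfolding upper_variation_def by (subst space_measure_of) auto

lemma sets_lower_variation [simp, measurable_cong]: "sets (lower_variation \<rho>) = sets borel"
  by (simp add: lower_variation_def)

text \<open>\<open>measure_of\<close> returns the given set function only if that is a measure. A
  Hahn set settles this: the supremum over subsets of \<open>A\<close> is attained at
  \<open>A \<inter> P\<close>, and countable additivity is inherited from \<rho>.\<close>

lemma emeasure_upper_variation:
  assumes \<rho>: "signed_borel_measure \<rho>" and P: "hahn_set \<rho> P" and A: "A \<in> sets borel"
  shows "emeasure (upper_variation \<rho>) A = ennreal (\<rho> (A \<inter> P))"
proof -
  have Pm [measurable]: "P \<in> sets borel" by (rule hahn_set_borel[OF P])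
  have nonneg: "0 \<le> \<rho> (A \<inter> P)" if "A \<in> sets borel" for A
    using that Pm by (intro hahn_set_nonneg[OF P]) auto
  let ?sup = "\<lambda>A. SUP B \<in> {B \<in> sets borel. B \<subseteq> A}. ennreal (\<rho> B)"
  have sup: "?sup A = ennreal (\<rho> (A \<inter> P))" if A: "A \<in> sets borel" for A
  proof (rule antisym)
    show "?sup A \<le> ennreal (\<rho> (A \<inter> P))"
    proof (rule SUP_least, clarsimp)
      fix B assume B: "B \<in> sets borel" "B \<subseteq> A"
      have "\<rho> (B - P) \<le> 0"
        using B Pm by (intro hahn_set_nonpos[OF P]) auto
      moreover have "0 \<le> \<rho> (A \<inter> P - B \<inter> P)"
        using A B Pm by (intro hahn_set_nonneg[OF P]) auto
      then have "\<rho> (B \<inter> P) \<le> \<rho> (A \<inter> P)"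
        using A B Pm signed_borel_measure_Diff[OF \<rho>, of "A \<inter> P" "B \<inter> P"] by (auto simp: le_infI1)
      ultimately show "ennreal (\<rho> B) \<le> ennreal (\<rho> (A \<inter> P))"
        using signed_borel_measure_split[OF \<rho> B(1), of P] by (intro ennreal_leI) simp
    qed
    show "ennreal (\<rho> (A \<inter> P)) \<le> ?sup A"
      using A by (intro SUP_upper) auto
  qed
  have "countably_additive (sets borel) ?sup"
  proof (rule countably_additiveI)
    fix F :: "nat \<Rightarrow> 'a set"
    assume F: "range F \<subseteq> sets borel" "disjoint_family F" "(\<Union>i. F i) \<in> sets borel"
    then have Fm [measurable]: "F i \<in> sets borel" for i by auto
    have "(\<lambda>i. \<rho> (F i \<inter> P)) sums \<rho> (\<Union>i. F i \<inter> P)"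
      using F(2) by (intro signed_borel_measure_sums[OF \<rho>]) (auto simp: disjoint_family_on_def)
    then have s: "(\<lambda>i. \<rho> (F i \<inter> P)) sums \<rho> ((\<Union>i. F i) \<inter> P)" by simp
    have "(\<Sum>i. ?sup (F i)) = (\<Sum>i. ennreal (\<rho> (F i \<inter> P)))"
      using sup[OF Fm] by simp
    also have "\<dots> = ennreal (\<rho> ((\<Union>i. F i) \<inter> P))"
      using suminf_ennreal2[OF nonneg[OF Fm] sums_summable[OF s]] sums_unique[OF s] by simp
    also have "\<dots> = ?sup (\<Union>i. F i)" using sup[OF F(3)] by simp
    finally show "(\<Sum>i. ?sup (F i)) = ?sup (\<Union>i. F i)" .
  qed
  moreover have "positive (sets borel) ?sup"
    using sup[OF sets.empty_sets] signed_borel_measure_empty[OF \<rho>] by (simp add: positive_def)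
  ultimately have "emeasure (upper_variation \<rho>) A = ?sup A"
    using A sets_upper_variation[of \<rho>] emeasure_measure_of[OF upper_variation_def[of \<rho>], of A]
    by simp
  then show ?thesis using sup[OF A] by simp
qed

lemma emeasure_lower_variation:
  assumes "signed_borel_measure \<rho>" "hahn_set \<rho> P" "A \<in> sets borel"
  shows "emeasure (lower_variation \<rho>) A = ennreal (- \<rho> (A - P))"
  using emeasure_upper_variation[OF signed_borel_measure_uminus hahn_set_uminus] assms
  by (simp add: lower_variation_def Diff_eq)

lemma finite_measure_upper_variation:
  assumes "signed_borel_measure \<rho>"
  shows "finite_measure (upper_variation \<rho>)"
proof -
  obtain P where "hahn_set \<rho> P" using Hahn_decomposition[OF assms] by blast
  then show ?thesis
    using emeasure_upper_variation[OF assms, of P UNIV] by (intro finite_measureI) simp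
qed

text \<open>For total mass zero the integral ignores additive constants, which is how translations
  later drop out of the denominator.\<close>

lemma signed_integral_const:
  assumes \<rho>: "signed_borel_measure \<rho>"
  shows "signed_integral \<rho> (\<lambda>x. c) = \<rho> UNIV *\<^sub>R c"
proof -
  obtain P where P: "hahn_set \<rho> P" using Hahn_decomposition[OF \<rho>] by blast
  then have m: "P \<in> sets borel" and "0 \<le> \<rho> P" "\<rho> (- P) \<le> 0"
    using hahn_set_borel[OF P] hahn_set_nonneg[OF P, of P] hahn_set_nonpos[OF P, of "- P"] by auto
  then have "measure (upper_variation \<rho>) UNIV = \<rho> P" "measure (lower_variation \<rho>) UNIV = - \<rho> (- P)"
    using emeasure_upper_variation[OF \<rho> P] emeasure_lower_variation[OF \<rho> P]
    by (simp_all add: measure_def Compl_eq_Diff_UNIV)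
  moreover have "\<rho> UNIV = \<rho> P + \<rho> (- P)"
    using signed_borel_measure_split[OF \<rho> _ m, of UNIV] by (simp add: Compl_eq_Diff_UNIV)
  ultimately show ?thesis
    by (simp add: signed_integral_def lower_variation_def scaleR_left_distrib)
qed

text \<open>The complement of the support is a union of possibly uncountably many null open sets.
  The Lindelof property extracts a countable subcover, to which countable additivity applies after
  disjointification.\<close>

lemma signed_borel_measure_outside_support:
  fixes \<rho> :: "'a::second_countable_topology set \<Rightarrow> real"
  assumes \<rho>: "signed_borel_measure \<rho>" and A: "A \<in> sets borel" "A \<inter> signed_support \<rho> = {}"
  shows "\<rho> A = 0"
proof -
  let ?F = "{U. open U \<and> (\<forall>A \<in> sets borel. A \<subseteq> U \<longrightarrow> \<rho> A = 0)}"
  obtain G where G: "G \<subseteq> ?F" "countable G" "\<Union>G = \<Union>?F"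
    using Lindelof[of ?F] by auto
  have null: "\<rho> B = 0" if "B \<in> sets borel" "B \<subseteq> U" "U \<in> G" for B U
    using that G(1) by blast
  have AG: "A \<subseteq> \<Union>G" using A(2) unfolding G(3) signed_support_def by blast
  show ?thesis
  \<comment> \<open>\<open>from_nat_into\<close> enumerates only a nonempty family, so the empty one
    is handled apart.\<close>
  proof (cases "G = {}")
    case True
    then have "A = {}" using AG by simp
    then show ?thesis using signed_borel_measure_empty[OF \<rho>] by simp
  next
    case False
    define U where "U = from_nat_into G"
    have UG: "U n \<in> G" for n using False by (simp add: U_def from_nat_into)
    then have om: "U n \<in> sets borel" for n using G(1) by (blast intro: borel_open)
    have dm: "disjointed U n \<in> sets borel" for n
      using sets.range_disjointed_sets[of U borel] om by blast
    have "range U = G"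
      unfolding U_def using False G(2) by (rule range_from_nat_into)
    then have "A \<subseteq> (\<Union>n. U n)"
      using AG by simp
    then have eq: "(\<Union>n. A \<inter> disjointed U n) = A" using UN_disjointed_eq[of U] by auto
    have "(\<lambda>n. \<rho> (A \<inter> disjointed U n)) sums \<rho> (\<Union>n. A \<inter> disjointed U n)"
      using disjoint_family_disjointed[of U] dm A(1)
      by (intro signed_borel_measure_sums[OF \<rho>]) (auto simp: disjoint_family_on_def)
    moreover have "\<rho> (A \<inter> disjointed U n) = 0" for n
      using null[OF _ _ UG[of n]] dm[of n] A(1) disjointed_subset[of U n] by blast
    ultimately show ?thesis
      unfolding eq using sums_unique2[OF _ sums_zero] by simp
  qed
qed

lemma signed_support_uminus: "signed_support (\<lambda>A. - \<rho> A) = signed_support \<rho>"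
  by (simp add: signed_support_def)

lemma closed_signed_support: "closed (signed_support \<rho>)"
  unfolding signed_support_def by (intro closed_Compl open_Union) auto

text \<open>The upper variation is finite and concentrated on the compact support, on which a
  continuous function is bounded.\<close>

lemma integrable_upper_variation:
  fixes f :: "'a::second_countable_topology \<Rightarrow> 'b::{banach, second_countable_topology}"
  assumes \<rho>: "signed_borel_measure \<rho>" and K: "compact (signed_support \<rho>)"
    and f: "continuous_on UNIV f"
  shows "integrable (upper_variation \<rho>) f"
proof -
  interpret finite_measure "upper_variation \<rho>"
    by (rule finite_measure_upper_variation[OF \<rho>])
  obtain P where P: "hahn_set \<rho> P" using Hahn_decomposition[OF \<rho>] by blast
  have "compact (f ` signed_support \<rho>)"
    using compact_continuous_image[OF continuous_on_subset[OF f] K] by simp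
  then obtain B where B: "\<And>x. x \<in> signed_support \<rho> \<Longrightarrow> norm (f x) \<le> B"
    by (metis bounded_iff compact_imp_bounded imageI)
  have m: "- signed_support \<rho> \<in> sets borel"
    using closed_signed_support[of \<rho>] by (intro borel_open) auto
  have "\<rho> (- signed_support \<rho> \<inter> P) = 0"
    using hahn_set_borel[OF P] m by (intro signed_borel_measure_outside_support[OF \<rho>]) auto
  then have "emeasure (upper_variation \<rho>) (- signed_support \<rho>) = 0"
    using emeasure_upper_variation[OF \<rho> P m] by simp
  then have "AE x in upper_variation \<rho>. x \<in> signed_support \<rho>"
    using m by (intro AE_I[of _ _ "- signed_support \<rho>"]) auto
  then have "AE x in upper_variation \<rho>. norm (f x) \<le> B"
    by eventually_elim (rule B)
  moreover have "f \<in> borel_measurable (upper_variation \<rho>)"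
    using borel_measurable_continuous_onI[OF f] by (simp cong: measurable_cong_sets)
  ultimately show ?thesis by (rule integrable_const_bound)
qed

lemma integrable_lower_variation:
  fixes f :: "'a::second_countable_topology \<Rightarrow> 'b::{banach, second_countable_topology}"
  assumes "signed_borel_measure \<rho>" "compact (signed_support \<rho>)" "continuous_on UNIV f"
  shows "integrable (lower_variation \<rho>) f"
  unfolding lower_variation_def using assms
  by (intro integrable_upper_variation signed_borel_measure_uminus) (simp_all add: signed_support_uminus)

lemma signed_integral_add:
  fixes f g :: "'a::second_countable_topology \<Rightarrow> 'b::{banach, second_countable_topology}"
  assumes "signed_borel_measure \<rho>" "compact (signed_support \<rho>)"
    and "continuous_on UNIV f" "continuous_on UNIV g"
  shows "signed_integral \<rho> (\<lambda>x. f x + g x) = signed_integral \<rho> f + signed_integral \<rho> g"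
  using assms by (simp add: signed_integral_def integrable_upper_variation integrable_lower_variation)

lemma signed_integral_cmult:
  fixes f :: "'a::topological_space \<Rightarrow> real"
  shows "signed_integral \<rho> (\<lambda>x. c * f x) = c * signed_integral \<rho> f"
  by (simp add: signed_integral_def algebra_simps)

lemma signed_integral_bounded_linear:
  fixes f :: "'a::second_countable_topology \<Rightarrow> 'b::{banach, second_countable_topology}"
    and L :: "'b \<Rightarrow> 'c::{banach, second_countable_topology}"
  assumes "signed_borel_measure \<rho>" "compact (signed_support \<rho>)" "continuous_on UNIV f"
    and L: "bounded_linear L"
  shows "signed_integral \<rho> (\<lambda>x. L (f x)) = L (signed_integral \<rho> f)"
  using assms
  by (simp add: signed_integral_def integral_bounded_linear integrable_upper_variation
      integrable_lower_variation linear_diff bounded_linear.linear)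

lemma signed_borel_measure_push_forward:
  assumes \<rho>: "signed_borel_measure \<rho>" and S: "S \<in> borel_measurable borel"
  shows "signed_borel_measure (push_forward S \<rho>)"
  unfolding signed_borel_measure_def
proof safe
  show "push_forward S \<rho> {} = 0"
    using signed_borel_measure_empty[OF \<rho>] by (simp add: push_forward_def)
  fix A :: "nat \<Rightarrow> 'b set" assume A: "range A \<subseteq> sets borel" "disjoint_family A"
  have "(\<lambda>i. \<rho> (S -` A i)) sums \<rho> (\<Union>i. S -` A i)"
    using A S by (intro signed_borel_measure_sums[OF \<rho>])
      (auto simp: disjoint_family_on_def in_borel_measurable_borel)
  then show "(\<lambda>i. push_forward S \<rho> (A i)) sums push_forward S \<rho> (\<Union> (range A))"
    by (simp add: push_forward_def vimage_UN)
qed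

lemma signed_integral_push_forward:
  fixes S :: "'a::topological_space \<Rightarrow> 'b::topological_space"
    and f :: "'b \<Rightarrow> 'c::{banach, second_countable_topology}"
  assumes \<rho>: "signed_borel_measure \<rho>"
    and S: "S \<in> borel_measurable borel" and T: "T \<in> borel_measurable borel"
    and TS: "\<And>x. T (S x) = x" and f: "f \<in> borel_measurable borel"
  shows "signed_integral (push_forward S \<rho>) f = signed_integral \<rho> (\<lambda>x. f (S x))"
proof -
  let ?\<mu> = "push_forward S \<rho>"
  have \<mu>: "signed_borel_measure ?\<mu>" by (rule signed_borel_measure_push_forward[OF \<rho> S])
  have Sm: "S -` A \<in> sets borel" if "A \<in> sets borel" for A
    using S that by (simp add: in_borel_measurable_borel)
  have Tm: "T -` A \<in> sets borel" if "A \<in> sets borel" for A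
    using T that by (simp add: in_borel_measurable_borel)
  obtain P where P: "hahn_set \<rho> P" using Hahn_decomposition[OF \<rho>] by blast
  have *: "positive_set (push_forward S \<rho>') (T -` Q)" if "positive_set \<rho>' Q" for Q and \<rho>' :: "'a set \<Rightarrow> real"
    unfolding positive_set_def
  proof safe
    show "T -` Q \<in> sets borel" using Tm that by (simp add: positive_set_def)
    fix B assume B: "B \<in> sets borel" "B \<subseteq> T -` Q"
    then have "S -` B \<subseteq> Q" using TS by force
    then show "0 \<le> push_forward S \<rho>' B"
      using that Sm[OF B(1)] by (simp add: push_forward_def positive_set_def)
  qed
  have Q: "hahn_set ?\<mu> (T -` P)"
    using *[of \<rho> P] *[of "\<lambda>A. - \<rho> A" "- P"] P
    by (simp add: hahn_set_def push_forward_def[abs_def] vimage_Compl)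
  have eq: "S -` (T -` P) = P" using TS by auto
  have "upper_variation ?\<mu> = distr (upper_variation \<rho>) borel S"
  proof (rule measure_eqI)
    fix A assume "A \<in> sets (upper_variation ?\<mu>)"
    then have A: "A \<in> sets borel" by simp
    have "emeasure (distr (upper_variation \<rho>) borel S) A = emeasure (upper_variation \<rho>) (S -` A)"
      using A S by (subst emeasure_distr) (auto cong: measurable_cong_sets)
    then show "emeasure (upper_variation ?\<mu>) A = emeasure (distr (upper_variation \<rho>) borel S) A"
      using emeasure_upper_variation[OF \<mu> Q A] emeasure_upper_variation[OF \<rho> P Sm[OF A]]
      by (simp add: push_forward_def eq)
  qed simp
  moreover have "lower_variation ?\<mu> = distr (lower_variation \<rho>) borel S"
  proof (rule measure_eqI)
    fix A assume "A \<in> sets (lower_variation ?\<mu>)"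
    then have A: "A \<in> sets borel" by simp
    have "emeasure (distr (lower_variation \<rho>) borel S) A = emeasure (lower_variation \<rho>) (S -` A)"
      using A S by (subst emeasure_distr) (auto simp: lower_variation_def cong: measurable_cong_sets)
    then show "emeasure (lower_variation ?\<mu>) A = emeasure (distr (lower_variation \<rho>) borel S) A"
      using emeasure_lower_variation[OF \<mu> Q A] emeasure_lower_variation[OF \<rho> P Sm[OF A]]
      by (simp add: push_forward_def eq vimage_Diff)
  qed simp
  moreover have "S \<in> measurable (upper_variation \<rho>) borel" "S \<in> measurable (lower_variation \<rho>) borel"
    using S by (simp_all cong: measurable_cong_sets)
  ultimately show ?thesis
    using f by (simp add: signed_integral_def integral_distr)
qed


subsection \<open>Similarities, Lebesgue measure and weak derivatives\<close>

lemma borel_measurable_affine [measurable]: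
  "(\<lambda>x. (A :: real^'m^'n) *v x + z) \<in> borel_measurable borel"
  by (intro borel_measurable_continuous_onI continuous_intros
      bounded_linear.continuous_on[OF matrix_vector_mul_bounded_linear])

lemma norm_orthogonal_matrix: "orthogonal_matrix Q \<Longrightarrow> norm (Q *v x) = norm x"
  for Q :: "real^'n^'n"
  by (rule orthogonal_transformation_norm)
    (simp add: orthogonal_transformation_matrix matrix_of_matrix_vector_mul)

lemma nn_integral_lborel_translate:
  fixes f :: "'a::euclidean_space \<Rightarrow> ennreal"
  assumes "f \<in> borel_measurable borel"
  shows "(\<integral>\<^sup>+x. f (c + x) \<partial>lborel) = (\<integral>\<^sup>+x. f x \<partial>lborel)"
  using assms nn_integral_distr[of "(+) c" lborel borel f] by (simp add: lborel_distr_plus)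

text \<open>The image measure is translation invariant and agrees with Lebesgue measure on the unit ball
  \<open>B\<close>; evaluating the double integral of \<open>1\<^sub>A(Q x) 1\<^sub>B(y - Q x)\<close> in two ways shows that it
  agrees everywhere.\<close>

lemma distr_lborel_orthogonal:
  fixes Q :: "real^'n^'n"
  assumes Q: "orthogonal_matrix Q"
  shows "distr lborel borel ((*v) Q) = lborel"
proof (rule measure_eqI)
  have [measurable]: "(*v) Q \<in> borel_measurable borel"
    using borel_measurable_affine[of Q 0] by simp
  fix A assume "A \<in> sets (distr lborel borel ((*v) Q))"
  then have A [measurable]: "A \<in> sets borel" by simp
  let ?B = "ball 0 1 :: (real^'n) set"
  define I :: "(real^'n) set \<Rightarrow> real^'n \<Rightarrow> ennreal" where "I = indicator"
  have I [measurable]: "I S \<in> borel_measurable borel" if "S \<in> sets borel" for S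
    using that by (simp add: I_def)
  have I_int: "(\<integral>\<^sup>+x. I S x \<partial>lborel) = emeasure lborel S" if "S \<in> sets borel" for S
    using that by (simp add: I_def)
  obtain R where "Q ** R = mat 1" using Q by (auto simp: orthogonal_matrix_def)
  then have inv: "Q *v (R *v y) = y" for y by (simp add: matrix_vector_mul_assoc)
  \<comment> \<open>Orthogonality enters here: the centred ball is invariant under \<open>Q\<close>
    and under reflection.\<close>
  have ball_inv: "I ?B (- (Q *v x)) = I ?B x" for x
    using norm_orthogonal_matrix[OF Q, of x] by (simp add: I_def indicator_def)
  have "(\<integral>\<^sup>+y. \<integral>\<^sup>+x. I A (Q *v x) * I ?B (y - Q *v x) \<partial>lborel \<partial>lborel)
      = (\<integral>\<^sup>+x. \<integral>\<^sup>+y. I A (Q *v x) * I ?B (y - Q *v x) \<partial>lborel \<partial>lborel)"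
    by (rule lborel_pair.Fubini') measurable
  also have "\<dots> = (\<integral>\<^sup>+x. I A (Q *v x) * emeasure lborel ?B \<partial>lborel)"
    using nn_integral_lborel_translate[OF I, of ?B "- (Q *v _)"]
    by (simp add: nn_integral_cmult I_int)
  also have "\<dots> = emeasure (distr lborel borel ((*v) Q)) A * emeasure lborel ?B"
    using nn_integral_distr[of "(*v) Q" lborel borel "I A"]
    by (simp add: nn_integral_multc I_def)
  finally have 1: "(\<integral>\<^sup>+y. \<integral>\<^sup>+x. I A (Q *v x) * I ?B (y - Q *v x) \<partial>lborel \<partial>lborel)
      = emeasure (distr lborel borel ((*v) Q)) A * emeasure lborel ?B" .
  \<comment> \<open>Translating \<open>x\<close> by \<open>R *v y\<close> turns
    \<open>Q *v x\<close> into \<open>Q *v x + y\<close> and \<open>y - Q *v x\<close> into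
    \<open>- (Q *v x)\<close>.\<close>
  have "(\<integral>\<^sup>+x. I A (Q *v x) * I ?B (y - Q *v x) \<partial>lborel)
      = (\<integral>\<^sup>+x. I A (Q *v x + y) * I ?B x \<partial>lborel)" for y
    by (subst nn_integral_lborel_translate[of _ "R *v y", symmetric])
      (simp_all add: matrix_vector_right_distrib inv ball_inv add.commute)
  then have "(\<integral>\<^sup>+y. \<integral>\<^sup>+x. I A (Q *v x) * I ?B (y - Q *v x) \<partial>lborel \<partial>lborel)
      = (\<integral>\<^sup>+y. \<integral>\<^sup>+x. I A (Q *v x + y) * I ?B x \<partial>lborel \<partial>lborel)"
    by simp
  also have "\<dots> = (\<integral>\<^sup>+x. \<integral>\<^sup>+y. I A (Q *v x + y) * I ?B x \<partial>lborel \<partial>lborel)"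
    by (rule lborel_pair.Fubini') measurable
  also have "\<dots> = (\<integral>\<^sup>+x. emeasure lborel A * I ?B x \<partial>lborel)"
    by (simp add: nn_integral_multc nn_integral_lborel_translate I_int)
  also have "\<dots> = emeasure lborel A * emeasure lborel ?B"
    by (simp add: nn_integral_cmult I_int)
  finally have "emeasure (distr lborel borel ((*v) Q)) A * emeasure lborel ?B
      = emeasure lborel A * emeasure lborel ?B"
    unfolding 1 .
  moreover have "emeasure lborel ?B \<noteq> 0"
    using open_not_negligible[of ?B] by (simp add: negligible_iff_emeasure0)
  moreover have "emeasure lborel ?B < \<infinity>" by (rule emeasure_lborel_ball_finite)
  ultimately show "emeasure (distr lborel borel ((*v) Q)) A = emeasure lborel A"
    by (auto simp: ennreal_mult_cancel_left mult.commute[of _ "emeasure lborel ?B"])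
qed simp

text \<open>Packing ratio and rotation into one matrix makes a similarity a plain affine map, so
  that the affine chain rule and test function lemmas apply directly.\<close>

definition similarity_matrix :: "real \<Rightarrow> real^'n^'n \<Rightarrow> bool" where
  "similarity_matrix c A \<longleftrightarrow> c > 0 \<and> (\<exists>Q. orthogonal_matrix Q \<and> A = c *\<^sub>R Q)"

lemma similarity_matrix_pos: "similarity_matrix c A \<Longrightarrow> 0 < c"
  by (simp add: similarity_matrix_def)

lemma similarity_matrix_transpose: "similarity_matrix c A \<Longrightarrow> similarity_matrix c (transpose A)"
  unfolding similarity_matrix_def
  by (auto simp: transpose_scalar orthogonal_matrix_transpose)

lemma norm_similarity_matrix: "similarity_matrix c A \<Longrightarrow> norm (A *v x) = c * norm x"
  by (auto simp: similarity_matrix_def norm_orthogonal_matrix simp flip: scaleR_matrix_vector_assoc)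

lemma invertible_similarity_matrix:
  assumes "similarity_matrix c A"
  shows "invertible A"
proof -
  obtain Q where Q: "c > 0" "orthogonal_matrix Q" "A = c *\<^sub>R Q"
    using assms by (auto simp: similarity_matrix_def)
  have "A ** ((1 / c) *\<^sub>R transpose Q) = mat 1" "((1 / c) *\<^sub>R transpose Q) ** A = mat 1"
    using Q by (simp_all add: orthogonal_matrix_def scalar_matrix_assoc matrix_scalar_ac)
  then show ?thesis unfolding invertible_def by blast
qed

text \<open>The rotation preserves Lebesgue measure, so the density \<open>c ^ n\<close> comes from
  the homothety alone.\<close>

lemma lborel_similarity:
  fixes A :: "real^'n^'n"
  assumes "similarity_matrix c A"
  shows "lborel = density (distr lborel borel (\<lambda>x. A *v x + z)) (\<lambda>_. ennreal (c ^ CARD('n)))"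
proof -
  obtain Q where Q: "c > 0" "orthogonal_matrix Q" "A = c *\<^sub>R Q"
    using assms by (auto simp: similarity_matrix_def)
  have [measurable]: "(*v) Q \<in> borel_measurable borel"
    using borel_measurable_affine[of Q 0] by simp
  have "distr lborel borel (\<lambda>x. A *v x + z) = distr (distr lborel borel ((*v) Q)) borel (\<lambda>x. z + c *\<^sub>R x)"
    by (subst distr_distr) (auto simp: Q(3) o_def add.commute simp flip: scaleR_matrix_vector_assoc)
  also have "\<dots> = distr lborel borel (\<lambda>x. z + c *\<^sub>R x)"
    by (simp add: distr_lborel_orthogonal[OF Q(2)])
  finally show ?thesis
    using lborel_affine[of c z] Q(1) by simp
qed

lemma integrable_lborel_affine:
  fixes A :: "real^'n^'n" and f :: "real^'n \<Rightarrow> real"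
  assumes A: "similarity_matrix c A" and f: "integrable lborel f"
  shows "integrable lborel (\<lambda>x. f (A *v x + z))"
proof -
  have [measurable]: "f \<in> borel_measurable borel" using borel_measurable_integrable[OF f] by simp
  have "integrable (density (distr lborel borel (\<lambda>x. A *v x + z)) (\<lambda>_. ennreal (c ^ CARD('n)))) f"
    using f by (subst (asm) lborel_similarity[OF A, of z])
  then have "integrable lborel (\<lambda>x. c ^ CARD('n) *\<^sub>R f (A *v x + z))"
    using similarity_matrix_pos[OF A] by (simp add: integrable_density integrable_distr_eq)
  then show ?thesis
    using similarity_matrix_pos[OF A] by simp
qed

text \<open>Stated for measurable functions so that it covers powers of gradient norms before their
  integrability is known; a function that is not integrable gives 0 on both sides.\<close>

lemma integral_lborel_affine:
  fixes A :: "real^'n^'n" and f :: "real^'n \<Rightarrow> real"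
  assumes A: "similarity_matrix c A" and f: "f \<in> borel_measurable borel"
  shows "(LINT x|lborel. f x) = c ^ CARD('n) * (LINT x|lborel. f (A *v x + z))"
proof -
  note [measurable] = f
  have "(LINT x|lborel. f x)
      = (LINT x|density (distr lborel borel (\<lambda>x. A *v x + z)) (\<lambda>_. ennreal (c ^ CARD('n))). f x)"
    by (subst lborel_similarity[OF A, of z]) (rule refl)
  also have "\<dots> = c ^ CARD('n) * (LINT x|lborel. f (A *v x + z))"
    using similarity_matrix_pos[OF A] by (simp add: integral_density integral_distr)
  finally show ?thesis .
qed

section \<open>Locally integrable functions and weak partial derivatives\<close>

lemma L1_loc_measurable: "u \<in> L1_loc \<Longrightarrow> u \<in> borel_measurable borel"
  by (simp add: L1_loc_def)

lemma L1_loc_continuous: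
  fixes u :: "real^'n \<Rightarrow> real"
  assumes u: "continuous_on UNIV u"
  shows "u \<in> L1_loc"
  unfolding L1_loc_def set_integrable_def
  using borel_integrable_compact[OF _ continuous_on_subset[OF u]]
    borel_measurable_continuous_onI[OF u] by auto

lemma L1_loc_add: "u \<in> L1_loc \<Longrightarrow> v \<in> L1_loc \<Longrightarrow> (\<lambda>x. u x + v x) \<in> L1_loc"
  by (auto simp: L1_loc_def intro: set_integral_add)

lemma L1_loc_cmult: "u \<in> L1_loc \<Longrightarrow> (\<lambda>x. c * u x) \<in> L1_loc"
  by (auto simp: L1_loc_def)

lemma L1_loc_sum: "(\<And>i. i \<in> I \<Longrightarrow> u i \<in> L1_loc) \<Longrightarrow> (\<lambda>x. \<Sum>i\<in>I. u i x) \<in> L1_loc"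
  by (induction I rule: infinite_finite_induct)
    (auto intro: L1_loc_add L1_loc_continuous)

lemma L1_loc_affine:
  fixes A :: "real^'n^'n"
  assumes A: "similarity_matrix c A" and u: "u \<in> L1_loc"
  shows "(\<lambda>x. u (A *v x + z)) \<in> L1_loc"
proof -
  let ?T = "\<lambda>x. A *v x + z"
  note [measurable] = L1_loc_measurable[OF u]
  obtain B where B: "B ** A = mat 1" using invertible_similarity_matrix[OF A] by (auto simp: invertible_def)
  have inj: "x = y" if "?T x = ?T y" for x y
  proof -
    have "B *v (A *v x) = B *v (A *v y)" using that by simp
    then show ?thesis by (simp add: matrix_vector_mul_assoc B)
  qed
  have "set_integrable lborel K (\<lambda>x. u (?T x))" if K: "compact K" for K
  proof -
    have "compact (?T ` K)"
      using K by (intro compact_continuous_image continuous_intros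
          bounded_linear.continuous_on[OF matrix_vector_mul_bounded_linear])
    then have "integrable lborel (\<lambda>x. indicator (?T ` K) x *\<^sub>R u x)"
      using u by (simp add: L1_loc_def set_integrable_def)
    then have "integrable lborel (\<lambda>x. indicator (?T ` K) (?T x) *\<^sub>R u (?T x))"
      by (rule integrable_lborel_affine[OF A])
    moreover have "?T x \<in> ?T ` K \<longleftrightarrow> x \<in> K" for x using inj by blast
    then have "indicator (?T ` K) (?T x) = (indicator K x :: real)" for x
      by (simp add: indicator_def)
    ultimately show ?thesis by (simp add: set_integrable_def)
  qed
  then show ?thesis by (simp add: L1_loc_def)
qed

lemma has_weak_partial_L1_loc: "has_weak_partial u i g \<Longrightarrow> g \<in> L1_loc"
  by (simp add: has_weak_partial_def)

lemma has_weak_partial_integral: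
  "has_weak_partial u i g \<Longrightarrow> test_function \<phi> \<Longrightarrow>
    (LINT x|lborel. u x * partial_deriv i \<phi> x) = - (LINT x|lborel. g x * \<phi> x)"
  by (simp add: has_weak_partial_def)

text \<open>This is what gives meaning to the choice made in \<open>weak_gradient\<close>: any
  explicitly known weak derivative agrees with the chosen one almost everywhere.\<close>

lemma has_weak_partial_unique:
  assumes "has_weak_partial u i g" "has_weak_partial u i h"
  shows "AE x in lborel. g x = h x"
proof -
  have g: "g \<in> L1_loc" "h \<in> L1_loc" using assms by (auto intro: has_weak_partial_L1_loc)
  have "AE x in lborel. g x + (- 1) * h x = 0"
  proof (rule fundamental_lemma_calculus_of_variations)
    show "(\<lambda>x. g x + (- 1) * h x) \<in> L1_loc" using g by (intro L1_loc_add L1_loc_cmult)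
    fix \<phi> :: "real^'a \<Rightarrow> real" assume \<phi>: "test_function \<phi>"
    have "(LINT x|lborel. (g x + (- 1) * h x) * \<phi> x)
        = (LINT x|lborel. g x * \<phi> x) - (LINT x|lborel. h x * \<phi> x)"
      using g[THEN integrable_L1_loc_mult_test_function, OF \<phi>] by (simp add: algebra_simps)
    then show "(LINT x|lborel. (g x + (- 1) * h x) * \<phi> x) = 0"
      using assms[THEN has_weak_partial_integral, OF \<phi>] by simp
  qed
  then show ?thesis by eventually_elim simp
qed

lemma has_weak_partial_linear:
  assumes u: "u \<in> L1_loc" "has_weak_partial u i g" and v: "v \<in> L1_loc" "has_weak_partial v i h"
  shows "has_weak_partial (\<lambda>x. a * u x + b * v x) i (\<lambda>x. a * g x + b * h x)"
  unfolding has_weak_partial_def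
proof (intro conjI allI impI)
  have g: "g \<in> L1_loc" "h \<in> L1_loc" using u v by (auto intro: has_weak_partial_L1_loc)
  show "(\<lambda>x. a * g x + b * h x) \<in> L1_loc" using g by (intro L1_loc_add L1_loc_cmult)
  fix \<phi> :: "real^'a \<Rightarrow> real" assume \<phi>: "test_function \<phi>"
  note d = test_function_partial_deriv[OF \<phi>, of i]
  have "(LINT x|lborel. (a * u x + b * v x) * partial_deriv i \<phi> x)
      = (LINT x|lborel. a * (u x * partial_deriv i \<phi> x) + b * (v x * partial_deriv i \<phi> x))"
    by (simp add: algebra_simps)
  also have "\<dots> = a * (LINT x|lborel. u x * partial_deriv i \<phi> x) + b * (LINT x|lborel. v x * partial_deriv i \<phi> x)"
    using integrable_L1_loc_mult_test_function[OF u(1) d] integrable_L1_loc_mult_test_function[OF v(1) d]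
    by simp
  also have "\<dots> = - (a * (LINT x|lborel. g x * \<phi> x) + b * (LINT x|lborel. h x * \<phi> x))"
    using has_weak_partial_integral[OF u(2) \<phi>] has_weak_partial_integral[OF v(2) \<phi>] by simp
  also have "a * (LINT x|lborel. g x * \<phi> x) + b * (LINT x|lborel. h x * \<phi> x)
      = (LINT x|lborel. a * (g x * \<phi> x) + b * (h x * \<phi> x))"
    using g[THEN integrable_L1_loc_mult_test_function, OF \<phi>] by simp
  also have "\<dots> = (LINT x|lborel. (a * g x + b * h x) * \<phi> x)"
    by (simp add: algebra_simps)
  finally show "(LINT x|lborel. (a * u x + b * v x) * partial_deriv i \<phi> x)
      = - (LINT x|lborel. (a * g x + b * h x) * \<phi> x)" .
qed

text \<open>The change of variables is moved to the test function: \<phi> is written as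
  \<open>\<psi>\<close> composed with the affine map, its partial derivative expands by the
  classical chain rule, and each term is an instance of the weak identity for \<open>u\<close>
  tested with \<open>\<psi>\<close>. The Jacobian \<open>c ^ n\<close> occurs on both sides and
  cancels.\<close>

lemma has_weak_partial_affine:
  fixes A :: "real^'n^'n"
  assumes A: "similarity_matrix c A" and u: "u \<in> L1_loc" and g: "\<And>i. has_weak_partial u i (g i)"
  shows "has_weak_partial (\<lambda>x. u (A *v x + z)) j (\<lambda>x. \<Sum>i\<in>UNIV. A $ i $ j * g i (A *v x + z))"
  unfolding has_weak_partial_def
proof (intro conjI allI impI)
  let ?T = "\<lambda>x. A *v x + z"
  have gL: "g i \<in> L1_loc" for i using g by (rule has_weak_partial_L1_loc)
  show "(\<lambda>x. \<Sum>i\<in>UNIV. A $ i $ j * g i (?T x)) \<in> L1_loc"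
    by (intro L1_loc_sum L1_loc_cmult L1_loc_affine[OF A] gL)
  fix \<phi> :: "real^'n \<Rightarrow> real" assume \<phi>: "test_function \<phi>"
  obtain B where B: "A ** B = mat 1" "B ** A = mat 1" using invertible_similarity_matrix[OF A] by (auto simp: invertible_def)
  define \<psi> where "\<psi> x = \<phi> (B *v x + - (B *v z))" for x
  have \<psi>: "test_function \<psi>"
    unfolding \<psi>_def using \<phi> B by (intro test_function_affine) (auto simp: invertible_def)
  have \<phi>_eq: "\<phi> = (\<lambda>x. \<psi> (?T x))"
    by (simp add: \<psi>_def fun_eq_iff matrix_vector_right_distrib matrix_vector_mul_assoc B)
  have d\<phi>: "partial_deriv j \<phi> x = (\<Sum>i\<in>UNIV. A $ i $ j * partial_deriv i \<psi> (?T x))" for x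
    unfolding \<phi>_eq by (intro partial_deriv_affine test_function_differentiable \<psi>)
  have int_u: "integrable lborel (\<lambda>x. u x * partial_deriv i \<psi> x)" for i
    by (intro integrable_L1_loc_mult_test_function u test_function_partial_deriv \<psi>)
  have int_g: "integrable lborel (\<lambda>x. g i x * \<psi> x)" for i
    by (intro integrable_L1_loc_mult_test_function gL \<psi>)
  note int_u' = integrable_lborel_affine[OF A int_u, where z = z]
  note int_g' = integrable_lborel_affine[OF A int_g, where z = z]
  have *: "(LINT x|lborel. u (?T x) * partial_deriv i \<psi> (?T x)) = - (LINT x|lborel. g i (?T x) * \<psi> (?T x))" for i
  proof -
    have "c ^ CARD('n) * (LINT x|lborel. u (?T x) * partial_deriv i \<psi> (?T x))
        = (LINT x|lborel. u x * partial_deriv i \<psi> x)"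
      using borel_measurable_integrable[OF int_u[of i]] by (subst integral_lborel_affine[OF A, where z = z]) auto
    also have "\<dots> = - (LINT x|lborel. g i x * \<psi> x)"
      by (rule has_weak_partial_integral[OF g \<psi>])
    also have "(LINT x|lborel. g i x * \<psi> x) = c ^ CARD('n) * (LINT x|lborel. g i (?T x) * \<psi> (?T x))"
      using borel_measurable_integrable[OF int_g[of i]] by (subst integral_lborel_affine[OF A, where z = z]) auto
    finally have "c ^ CARD('n) * (LINT x|lborel. u (?T x) * partial_deriv i \<psi> (?T x))
        = c ^ CARD('n) * - (LINT x|lborel. g i (?T x) * \<psi> (?T x))" by simp
    then show ?thesis
      using similarity_matrix_pos[OF A] unfolding mult_cancel_left by simp
  qed
  have "(LINT x|lborel. u (?T x) * partial_deriv j \<phi> x)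
      = (LINT x|lborel. (\<Sum>i\<in>UNIV. A $ i $ j * (u (?T x) * partial_deriv i \<psi> (?T x))))"
    by (simp add: d\<phi> sum_distrib_left mult_ac)
  also have "\<dots> = (\<Sum>i\<in>UNIV. A $ i $ j * (LINT x|lborel. u (?T x) * partial_deriv i \<psi> (?T x)))"
    using int_u' by simp
  also have "\<dots> = - (\<Sum>i\<in>UNIV. A $ i $ j * (LINT x|lborel. g i (?T x) * \<psi> (?T x)))"
    unfolding * by (simp add: sum_negf)
  also have "(\<Sum>i\<in>UNIV. A $ i $ j * (LINT x|lborel. g i (?T x) * \<psi> (?T x)))
      = (LINT x|lborel. (\<Sum>i\<in>UNIV. A $ i $ j * (g i (?T x) * \<psi> (?T x))))"
    using int_g' by simp
  also have "\<dots> = (LINT x|lborel. (\<Sum>i\<in>UNIV. A $ i $ j * g i (?T x)) * \<phi> x)"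
    unfolding \<phi>_eq by (simp add: sum_distrib_right mult.assoc)
  finally show "(LINT x|lborel. u (?T x) * partial_deriv j \<phi> x)
      = - (LINT x|lborel. (\<Sum>i\<in>UNIV. A $ i $ j * g i (?T x)) * \<phi> x)" .
qed


subsection \<open>Strict convexity\<close>

text \<open>The mean value theorem on the two halves of the interval, together with strict
  monotonicity of the derivative \<open>p * x powr (p - 1)\<close>, makes the increment over the
  right half the larger one.\<close>

lemma powr_midpoint_less:
  fixes s t p :: real
  assumes "p > 1" "0 \<le> s" "s < t"
  shows "((s + t) / 2) powr p < (s powr p + t powr p) / 2"
proof -
  define m where "m = (s + t) / 2"
  have m: "s < m" "m < t" "0 < m" using assms by (simp_all add: m_def)
  have cont: "continuous_on {a..b} (\<lambda>x. x powr p)" if "0 \<le> a" for a b :: real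
    using that assms(1) by (intro continuous_on_powr' continuous_intros) auto
  have der: "((\<lambda>x. x powr p) has_derivative ((*) (p * x powr (p - 1)))) (at x)" if "0 < x" for x
    using has_real_derivative_powr[OF that, of p]
    by (simp add: has_field_derivative_def)
  obtain \<xi> where \<xi>: "s < \<xi>" "\<xi> < m" "m powr p - s powr p = p * \<xi> powr (p - 1) * (m - s)"
    by (rule mvt[OF m(1) cont der]) (use assms in auto)
  obtain \<eta> where \<eta>: "m < \<eta>" "\<eta> < t" "t powr p - m powr p = p * \<eta> powr (p - 1) * (t - m)"
    by (rule mvt[OF m(2) cont der]) (use m in auto)
  have "\<xi> powr (p - 1) < \<eta> powr (p - 1)"
    using \<xi> \<eta> assms by (intro powr_less_mono2) auto
  then have "p * \<xi> powr (p - 1) * (m - s) < p * \<eta> powr (p - 1) * (m - s)"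
    using m(1) assms(1) by (intro mult_strict_right_mono mult_strict_left_mono) auto
  moreover have "t - m = m - s" by (simp add: m_def field_simps)
  ultimately have "m powr p - s powr p < t powr p - m powr p"
    unfolding \<xi>(3) \<eta>(3) by simp
  then show ?thesis unfolding m_def by simp
qed

lemma powr_midpoint_le:
  fixes s t p :: real
  assumes "p > 1" "0 \<le> s" "0 \<le> t"
  shows "((s + t) / 2) powr p \<le> (s powr p + t powr p) / 2"
    and "((s + t) / 2) powr p = (s powr p + t powr p) / 2 \<Longrightarrow> s = t"
  using powr_midpoint_less[of p s t] powr_midpoint_less[of p t s] assms
  by (cases s t rule: linorder_cases; simp add: add.commute[of t s] add.commute[of "t powr p" "s powr p"])+

lemma norm_powr_midpoint_le:
  fixes a b :: "'a::real_normed_vector"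
  assumes "p > 1"
  shows "norm ((1 / 2) *\<^sub>R (a + b)) powr p \<le> (norm a powr p + norm b powr p) / 2"
proof -
  have "norm ((1 / 2) *\<^sub>R (a + b)) powr p \<le> ((norm a + norm b) / 2) powr p"
    using norm_triangle_ineq[of a b] assms by (intro powr_mono2) auto
  also have "\<dots> \<le> (norm a powr p + norm b powr p) / 2"
    by (intro powr_midpoint_le assms norm_ge_zero)
  finally show ?thesis .
qed

text \<open>Equality forces equality in both links of the chain behind
  \<open>norm_powr_midpoint_le\<close>. The scalar link gives \<open>norm a = norm b\<close>, the
  triangle inequality then gives \<open>norm (a + b) = 2 * norm a\<close>, and the parallelogram law
  leaves \<open>norm (a - b) = 0\<close>.\<close>

lemma norm_powr_midpoint_eq_imp:
  fixes a b :: "'a::real_inner"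
  assumes p: "p > 1"
    and eq: "norm ((1 / 2) *\<^sub>R (a + b)) powr p = (norm a powr p + norm b powr p) / 2"
  shows "a = b"
proof -
  have le: "norm ((1 / 2) *\<^sub>R (a + b)) powr p \<le> ((norm a + norm b) / 2) powr p"
    using norm_triangle_ineq[of a b] p by (intro powr_mono2) auto
  have "((norm a + norm b) / 2) powr p = (norm a powr p + norm b powr p) / 2"
    using powr_midpoint_le(1)[OF p norm_ge_zero[of a] norm_ge_zero[of b]] le unfolding eq by (rule antisym)
  from powr_midpoint_le(2)[OF p norm_ge_zero norm_ge_zero this]
  have ab: "norm a = norm b" .
  have "norm (a + b) = 2 * norm a"
  proof (rule antisym)
    show "norm (a + b) \<le> 2 * norm a" using norm_triangle_ineq[of a b] ab by simp
    show "2 * norm a \<le> norm (a + b)"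
    proof (rule ccontr)
      assume "\<not> 2 * norm a \<le> norm (a + b)"
      then have "norm ((1 / 2) *\<^sub>R (a + b)) powr p < norm a powr p"
        using p by (intro powr_less_mono2) auto
      then show False using eq ab by simp
    qed
  qed
  then have "(norm (a + b))\<^sup>2 = 4 * (norm a)\<^sup>2" by (simp add: power_mult_distrib)
  moreover have "(norm (a + b))\<^sup>2 + (norm (a - b))\<^sup>2 = 2 * (norm a)\<^sup>2 + 2 * (norm b)\<^sup>2"
    by (simp add: power2_norm_eq_inner inner_simps inner_commute)
  ultimately have "(norm (a - b))\<^sup>2 = 0" using ab by simp
  then show ?thesis by simp
qed

text \<open>Comparing p-th powers avoids the Minkowski inequality: the pointwise convexity defect
  \<open>?d\<close> is nonnegative and its integral is at most \<open>I - I\<close>, so it vanishes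
  almost everywhere and the pointwise equality case applies.\<close>

lemma Lp_norm_strictly_convex:
  fixes f g :: "'a \<Rightarrow> 'b::real_inner"
  assumes p: "p > 1"
    and f: "integrable M (\<lambda>x. norm (f x) powr p)" "(LINT x|M. norm (f x) powr p) \<le> I"
    and g: "integrable M (\<lambda>x. norm (g x) powr p)" "(LINT x|M. norm (g x) powr p) \<le> I"
    and h: "integrable M (\<lambda>x. norm ((1 / 2) *\<^sub>R (f x + g x)) powr p)"
      "I \<le> (LINT x|M. norm ((1 / 2) *\<^sub>R (f x + g x)) powr p)"
  shows "AE x in M. f x = g x"
proof -
  let ?d = "\<lambda>x. (norm (f x) powr p + norm (g x) powr p) / 2 - norm ((1 / 2) *\<^sub>R (f x + g x)) powr p"
  have int: "integrable M ?d" using f(1) g(1) h(1) by simp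
  have nonneg: "0 \<le> ?d x" for x using norm_powr_midpoint_le[OF p, of "f x" "g x"] by simp
  have "(LINT x|M. ?d x) = ((LINT x|M. norm (f x) powr p) + (LINT x|M. norm (g x) powr p)) / 2
      - (LINT x|M. norm ((1 / 2) *\<^sub>R (f x + g x)) powr p)"
    using f(1) g(1) h(1) by simp
  also have "\<dots> \<le> 0" using f(2) g(2) h(2) by simp
  finally have "(LINT x|M. ?d x) \<le> 0" .
  moreover have "0 \<le> (LINT x|M. ?d x)"
    by (rule integral_nonneg_AE, rule AE_I2, rule nonneg)
  ultimately have "(LINT x|M. ?d x) = 0" by (rule antisym)
  then have "AE x in M. ?d x = 0"
    using integral_nonneg_eq_0_iff_AE[OF int] nonneg by simp
  then show ?thesis
    by eventually_elim (rule norm_powr_midpoint_eq_imp[OF p], simp)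
qed


subsection \<open>Vanishing weak derivatives\<close>

text \<open>The set where a continuous function is nonzero is open, and an open Lebesgue null set is
  empty.\<close>

lemma AE_lborel_zero_imp_zero:
  fixes g :: "'a::euclidean_space \<Rightarrow> real"
  assumes g: "continuous_on UNIV g" and 0: "AE x in lborel. g x = 0"
  shows "g x = 0"
proof -
  have o: "open {x. g x \<noteq> 0}"
    using open_Collect_neq[OF g continuous_on_const[of UNIV 0]] by simp
  then have "{x. g x \<noteq> 0} \<in> null_sets lborel"
    using 0 by (simp add: AE_iff_null_sets)
  then have "negligible {x. g x \<noteq> 0}"
    by (simp add: negligible_iff_null_sets null_sets_completionI)
  then have "{x. g x \<noteq> 0} = {}" using open_not_negligible[OF o] by blast
  then show ?thesis by blast
qed

text \<open>A bridge from the Lebesgue integral of weak derivatives to the gauge integral over a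
  box, for which the Leibniz rule is formulated.\<close>

lemma continuous_on_mult_test_function_integral:
  fixes W \<phi> :: "real^'n \<Rightarrow> real"
  assumes W: "continuous_on UNIV W" and \<phi>: "test_function \<phi>"
    and S: "\<And>x. \<phi> x \<noteq> 0 \<Longrightarrow> x \<in> S"
  shows "(LINT x|lborel. W x * \<phi> x) = integral S (\<lambda>x. W x * \<phi> x)"
proof -
  have "(LINT x|lborel. W x * \<phi> x) = integral UNIV (\<lambda>x. W x * \<phi> x)"
    by (rule integral_lborel[symmetric],
        rule integrable_L1_loc_mult_test_function[OF L1_loc_continuous[OF W] \<phi>])
  also have "\<dots> = integral UNIV (\<lambda>x. if x \<in> S then W x * \<phi> x else 0)"
    using S by (intro arg_cong[of _ _ "integral UNIV"] ext) auto
  also have "\<dots> = integral S (\<lambda>x. W x * \<phi> x)"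
    by (rule Henstock_Kurzweil_Integration.integral_restrict_UNIV)
  finally show ?thesis .
qed

lemma similarity_matrix_mat_1: "similarity_matrix 1 (mat 1)"
  unfolding similarity_matrix_def by (auto intro!: exI[of _ "mat 1"] simp: orthogonal_matrix_id)

lemma test_function_translate: "test_function \<phi> \<Longrightarrow> test_function (\<lambda>x. \<phi> (x + z))"
  using test_function_affine[OF _ invertible_similarity_matrix[OF similarity_matrix_mat_1], of \<phi> z]
  by simp

lemma partial_deriv_translate:
  assumes "test_function \<phi>"
  shows "partial_deriv i (\<lambda>x. \<phi> (x + z)) = (\<lambda>x. partial_deriv i \<phi> (x + z))"
proof
  fix x
  have "(\<phi> has_derivative frechet_derivative \<phi> (at (x + z))) (at (x + z))"
    using test_function_differentiable[OF assms] by (simp add: frechet_derivative_works)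
  moreover have "((\<lambda>x. x + z) has_derivative (\<lambda>h. h)) (at x)"
    by (auto intro!: derivative_eq_intros)
  ultimately have "((\<lambda>x. \<phi> (x + z)) has_derivative frechet_derivative \<phi> (at (x + z))) (at x)"
    by (rule has_derivative_compose[rotated])
  then show "partial_deriv i (\<lambda>x. \<phi> (x + z)) x = partial_deriv i \<phi> (x + z)"
    by (subst partial_deriv_eqI) (auto simp: partial_deriv_def)
qed

text \<open>The integral of \<open>W\<close> against a translate of a test function has derivative zero in the
  translation parameter.\<close>

lemma integral_translate_weak_partial_zero:
  fixes W \<phi> :: "real^'n \<Rightarrow> real"
  assumes W: "continuous_on UNIV W" "has_weak_partial W i (\<lambda>x. 0)" and \<phi>: "test_function \<phi>"
  shows "(LINT x|lborel. W x * \<phi> (x + t *\<^sub>R axis i 1)) = (LINT x|lborel. W x * \<phi> x)"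
proof -
  let ?e = "axis i 1 :: real^'n" and ?J = "{- \<bar>t\<bar>..\<bar>t\<bar>}"
  \<comment> \<open>One box has to contain the supports of all translates with parameter in
    \<open>?J\<close>, so that the domain of integration does not vary with
    \<open>s\<close>.\<close>
  have "compact ((\<lambda>(x, s). x - s *\<^sub>R ?e) ` (closure {x. \<phi> x \<noteq> 0} \<times> ?J))"
    using \<phi> by (intro compact_continuous_image compact_Times)
      (auto simp: test_function_def split_beta intro!: continuous_intros)
  then obtain a b where ab: "(\<lambda>(x, s). x - s *\<^sub>R ?e) ` (closure {x. \<phi> x \<noteq> 0} \<times> ?J) \<subseteq> cbox a b"
    by (meson bounded_subset_cbox_symmetric compact_imp_bounded)
  have supp: "x \<in> cbox a b" if "\<phi> (x + s *\<^sub>R ?e) \<noteq> 0" "s \<in> ?J" for x s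
  proof -
    have "x + s *\<^sub>R ?e \<in> closure {x. \<phi> x \<noteq> 0}"
      using that(1) closure_subset[of "{x. \<phi> x \<noteq> 0}"] by auto
    then have "(\<lambda>(x, s). x - s *\<^sub>R ?e) (x + s *\<^sub>R ?e, s) \<in> cbox a b"
      using ab that(2) by blast
    then show ?thesis by simp
  qed
  define F where "F s = (LINT x|lborel. W x * \<phi> (x + s *\<^sub>R ?e))" for s
  have cW: "continuous_on X (\<lambda>z. W (f z))" if "continuous_on X f" for X :: "'b::topological_space set" and f
    using continuous_on_compose2[OF W(1) that] by simp
  have c\<phi>: "continuous_on X (\<lambda>z. \<phi> (f z))" if "continuous_on X f" for X :: "'b::topological_space set" and f
    using continuous_on_compose2[OF test_function_continuous[OF \<phi>] that] by simp
  have cd\<phi>: "continuous_on X (\<lambda>z. partial_deriv i \<phi> (f z))" if "continuous_on X f" for X :: "'b::topological_space set" and f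
    using continuous_on_compose2[OF test_function_continuous[OF test_function_partial_deriv[OF \<phi>]] that] by simp
  have F_eq: "F s = integral (cbox a b) (\<lambda>x. W x * \<phi> (x + s *\<^sub>R ?e))" if "s \<in> ?J" for s
    unfolding F_def using supp that
    by (intro continuous_on_mult_test_function_integral W test_function_translate \<phi>) blast
  have dF: "((\<lambda>s. integral (cbox a b) (\<lambda>x. W x * \<phi> (x + s *\<^sub>R ?e))) has_field_derivative
      integral (cbox a b) (\<lambda>x. W x * partial_deriv i \<phi> (x + s *\<^sub>R ?e))) (at s within ?J)"
    if "s \<in> ?J" for s
  proof (rule leibniz_rule_field_derivative[OF _ _ _ that])
    fix s x
    have "(\<phi> has_derivative frechet_derivative \<phi> (at (x + s *\<^sub>R ?e))) (at (x + s *\<^sub>R ?e))"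
      using test_function_differentiable[OF \<phi>] by (simp add: frechet_derivative_works)
    note lin = has_derivative_linear[OF this]
    have "((\<lambda>s. x + s *\<^sub>R ?e) has_derivative (\<lambda>h. h *\<^sub>R ?e)) (at s within ?J)"
      by (auto intro!: derivative_eq_intros)
    from has_derivative_compose[OF this \<open>(\<phi> has_derivative _) _\<close>]
    have "((\<lambda>s. \<phi> (x + s *\<^sub>R ?e)) has_field_derivative partial_deriv i \<phi> (x + s *\<^sub>R ?e)) (at s within ?J)"
      unfolding has_field_derivative_def partial_deriv_def
      by (simp add: linear_cmul[OF lin] mult.commute[of _ "frechet_derivative \<phi> _ _"] fun_eq_iff)
    then show "((\<lambda>s. W x * \<phi> (x + s *\<^sub>R ?e)) has_field_derivative
        W x * partial_deriv i \<phi> (x + s *\<^sub>R ?e)) (at s within ?J)"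
      by (rule DERIV_cmult)
  next
    show "(\<lambda>x. W x * \<phi> (x + s *\<^sub>R ?e)) integrable_on cbox a b" for s
      by (intro integrable_continuous continuous_intros cW c\<phi>)
    show "continuous_on (?J \<times> cbox a b) (\<lambda>(s, x). W x * partial_deriv i \<phi> (x + s *\<^sub>R ?e))"
      unfolding split_beta by (intro continuous_intros cW cd\<phi>)
  qed simp
  \<comment> \<open>The derivative under the integral sign is \<open>W\<close> tested with a partial
    derivative of the translated test function, so the weak derivative 0 makes it vanish.\<close>
  have zero: "integral (cbox a b) (\<lambda>x. W x * partial_deriv i \<phi> (x + s *\<^sub>R ?e)) = 0" if "s \<in> ?J" for s
  proof -
    let ?\<phi> = "\<lambda>x. \<phi> (x + s *\<^sub>R ?e)"
    have t: "test_function ?\<phi>" by (rule test_function_translate[OF \<phi>])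
    have van: "partial_deriv i ?\<phi> x = 0" if "x \<notin> cbox a b" for x
    proof -
      have "((\<lambda>x :: real^'n. 0 :: real) has_derivative (\<lambda>h. 0)) (at x)" by simp
      then have "(?\<phi> has_derivative (\<lambda>h. 0)) (at x)"
        by (rule has_derivative_transform_within_open[where s = "- cbox a b"])
          (use supp[OF _ \<open>s \<in> ?J\<close>] that in \<open>auto simp: open_Compl\<close>)
      then show ?thesis by (rule partial_deriv_eqI)
    qed
    have "0 = (LINT x|lborel. W x * partial_deriv i ?\<phi> x)"
      using has_weak_partial_integral[OF W(2) t] by simp
    also have "\<dots> = integral (cbox a b) (\<lambda>x. W x * partial_deriv i ?\<phi> x)"
      using van by (intro continuous_on_mult_test_function_integral W test_function_partial_deriv t) blast
    finally show ?thesis by (simp add: partial_deriv_translate[OF \<phi>])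
  qed
  have "(F has_field_derivative 0) (at s within ?J)" if "s \<in> ?J" for s
    using dF[OF that] unfolding zero[OF that]
    by (rule has_field_derivative_transform_within[OF _ zero_less_one that]) (rule F_eq[symmetric])
  then obtain c where "\<forall>s\<in>?J. F s = c"
    using has_field_derivative_zero_constant[of ?J F] by auto
  moreover have "t \<in> ?J" "0 \<in> ?J" by auto
  ultimately have "F t = F 0" by metis
  then show ?thesis by (simp add: F_def)
qed

text \<open>Shifting the test function along an axis does not change its integral against
  \<open>W\<close>; a change of variables moves the shift to \<open>W\<close>, and the fundamental
  lemma with continuity makes \<open>W\<close> invariant under every axis translation.\<close>

lemma constant_if_weak_partials_zero:
  fixes W :: "real^'n \<Rightarrow> real"
  assumes W: "continuous_on UNIV W" and 0: "\<And>i. has_weak_partial W i (\<lambda>x. 0)"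
  shows "W x = W 0"
proof -
  have shift: "W (x - t *\<^sub>R axis i 1) = W x" for x t i
  proof -
    let ?z = "- (t *\<^sub>R axis i 1) :: real^'n"
    have cW: "continuous_on UNIV (\<lambda>x. W (x + ?z))"
      by (intro continuous_on_compose2[OF W] continuous_intros) auto
    then have cont: "continuous_on UNIV (\<lambda>x. W (x + ?z) - W x)"
      by (intro continuous_on_diff W)
    have "AE x in lborel. W (x + ?z) - W x = 0"
    proof (rule fundamental_lemma_calculus_of_variations[OF L1_loc_continuous[OF cont]])
      fix \<phi> :: "real^'n \<Rightarrow> real" assume \<phi>: "test_function \<phi>"
      let ?f = "\<lambda>x. W x * \<phi> (x + t *\<^sub>R axis i 1)"
      have "integrable lborel ?f"
        by (intro integrable_L1_loc_mult_test_function L1_loc_continuous W test_function_translate \<phi>)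
      then have f: "?f \<in> borel_measurable borel" using borel_measurable_integrable by force
      have "(LINT x|lborel. W x * \<phi> x) = (LINT x|lborel. ?f x)"
        using integral_translate_weak_partial_zero[OF W 0 \<phi>] by simp
      also have "\<dots> = (LINT x|lborel. W (x + ?z) * \<phi> x)"
        using integral_lborel_affine[OF similarity_matrix_mat_1 f, of ?z] by simp
      finally have "(LINT x|lborel. W (x + ?z) * \<phi> x) - (LINT x|lborel. W x * \<phi> x) = 0" by simp
      then show "(LINT x|lborel. (W (x + ?z) - W x) * \<phi> x) = 0"
        using integrable_L1_loc_mult_test_function[OF L1_loc_continuous[OF cW] \<phi>]
          integrable_L1_loc_mult_test_function[OF L1_loc_continuous[OF W] \<phi>]
        by (simp add: left_diff_distrib)
    qed
    from AE_lborel_zero_imp_zero[OF cont this] show ?thesis by simp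
  qed
  \<comment> \<open>The coordinates of \<open>x\<close> are removed one at a time by axis
    translations.\<close>
  have "W (\<Sum>i\<in>I. x $ i *\<^sub>R axis i 1) = W 0" if "finite I" for I
    using that
  proof (induction I)
    case (insert i I)
    then show ?case
      using shift[of "\<Sum>i\<in>insert i I. x $ i *\<^sub>R axis i 1" "x $ i" i] by simp
  qed simp
  from this[of UNIV] show ?thesis
    using basis_expansion[of x] by (simp add: scalar_mult_eq_scaleR)
qed


subsection \<open>The homogeneous Sobolev space and the Morrey constant\<close>

lemma holder_continuous_imp_continuous_on:
  assumes u: "holder_continuous \<alpha> u" and \<alpha>: "0 < \<alpha>"
  shows "continuous_on UNIV u"
proof -
  obtain C where C: "\<And>x y. \<bar>u x - u y\<bar> \<le> C * norm (x - y) powr \<alpha>"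
    using u unfolding holder_continuous_def by blast
  have "(u \<longlongrightarrow> u x) (at x)" for x
  proof (rule Lim_null_comparison[THEN LIM_zero_cancel])
    show "\<forall>\<^sub>F y in at x. norm (u y - u x) \<le> C * norm (y - x) powr \<alpha>"
      using C by (simp add: always_eventually)
    have "((\<lambda>y. C * norm (y - x) powr \<alpha>) \<longlongrightarrow> C * norm (x - x) powr \<alpha>) (at x)"
      using \<alpha> by (intro tendsto_intros tendsto_powr2) (auto intro: always_eventually)
    then show "((\<lambda>y. C * norm (y - x) powr \<alpha>) \<longlongrightarrow> 0) (at x)"
      using \<alpha> by simp
  qed
  then show ?thesis by (simp add: continuous_on_def)
qed

lemma holder_continuous_linear:
  assumes "holder_continuous \<alpha> u" "holder_continuous \<alpha> v"
  shows "holder_continuous \<alpha> (\<lambda>x. a * u x + b * v x)"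
proof -
  obtain C D where C: "\<And>x y. \<bar>u x - u y\<bar> \<le> C * norm (x - y) powr \<alpha>"
    and D: "\<And>x y. \<bar>v x - v y\<bar> \<le> D * norm (x - y) powr \<alpha>"
    using assms unfolding holder_continuous_def by blast
  have "\<bar>(a * u x + b * v x) - (a * u y + b * v y)\<bar> \<le> (\<bar>a\<bar> * C + \<bar>b\<bar> * D) * norm (x - y) powr \<alpha>" for x y
  proof -
    have "\<bar>(a * u x + b * v x) - (a * u y + b * v y)\<bar> = \<bar>a * (u x - u y) + b * (v x - v y)\<bar>"
      by (simp add: algebra_simps)
    also have "\<dots> \<le> \<bar>a\<bar> * \<bar>u x - u y\<bar> + \<bar>b\<bar> * \<bar>v x - v y\<bar>"
      by (metis abs_mult abs_triangle_ineq)
    also have "\<dots> \<le> \<bar>a\<bar> * (C * norm (x - y) powr \<alpha>) + \<bar>b\<bar> * (D * norm (x - y) powr \<alpha>)"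
      by (intro add_mono mult_left_mono C D abs_ge_zero)
    finally show ?thesis by (simp add: algebra_simps)
  qed
  then show ?thesis unfolding holder_continuous_def by blast
qed

lemma holder_continuous_similarity:
  assumes A: "similarity_matrix c A" and u: "holder_continuous \<alpha> u"
  shows "holder_continuous \<alpha> (\<lambda>x. u (A *v x + z))"
proof -
  obtain C where C: "\<And>x y. \<bar>u x - u y\<bar> \<le> C * norm (x - y) powr \<alpha>"
    using u unfolding holder_continuous_def by blast
  have "\<bar>u (A *v x + z) - u (A *v y + z)\<bar> \<le> (C * c powr \<alpha>) * norm (x - y) powr \<alpha>" for x y
    using C[of "A *v x + z" "A *v y + z"] norm_similarity_matrix[OF A, of "x - y"] similarity_matrix_pos[OF A]
    by (simp add: matrix_vector_mult_diff_distrib powr_mult)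
  then show ?thesis unfolding holder_continuous_def by blast
qed

section \<open>Closure properties of \<open>Lp\<close> and of \<open>D1p\<close>\<close>

lemma Lp_cmult: "g \<in> Lp p \<Longrightarrow> (\<lambda>x. a * g x) \<in> Lp p"
  by (auto simp: Lp_def abs_mult powr_mult)

lemma Lp_add:
  assumes p: "0 < p" and g: "g \<in> Lp p" "h \<in> Lp p"
  shows "(\<lambda>x. g x + h x) \<in> Lp p"
proof -
  have [measurable]: "g \<in> borel_measurable borel" "h \<in> borel_measurable borel"
    using g by (simp_all add: Lp_def)
  have "integrable lborel (\<lambda>x. 2 powr p * (\<bar>g x\<bar> powr p + \<bar>h x\<bar> powr p))"
    using g by (simp add: Lp_def)
  then have "integrable lborel (\<lambda>x. \<bar>g x + h x\<bar> powr p)"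
  proof (rule Bochner_Integration.integrable_bound)
    have "\<bar>s + t\<bar> powr p \<le> 2 powr p * (\<bar>s\<bar> powr p + \<bar>t\<bar> powr p)" for s t :: real
    proof -
      \<comment> \<open>A crude bound by twice the larger term is enough, as only membership in
        \<open>Lp\<close> is at stake.\<close>
      have "\<bar>s + t\<bar> powr p \<le> (2 * max \<bar>s\<bar> \<bar>t\<bar>) powr p"
        using p by (intro powr_mono2) auto
      also have "\<dots> = 2 powr p * max \<bar>s\<bar> \<bar>t\<bar> powr p" by (simp add: powr_mult)
      also have "\<dots> \<le> 2 powr p * (\<bar>s\<bar> powr p + \<bar>t\<bar> powr p)"
        by (intro mult_left_mono) (auto simp: max_def)
      finally show ?thesis .
    qed
    then show "AE x in lborel. norm (\<bar>g x + h x\<bar> powr p) \<le> norm (2 powr p * (\<bar>g x\<bar> powr p + \<bar>h x\<bar> powr p))"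
      by (intro AE_I2) (simp add: abs_of_nonneg)
  qed measurable
  then show ?thesis by (simp add: Lp_def)
qed

lemma Lp_sum:
  assumes "0 < p" "\<And>i. i \<in> I \<Longrightarrow> g i \<in> Lp p"
  shows "(\<lambda>x. \<Sum>i\<in>I. g i x) \<in> Lp p"
  using assms(2)
proof (induction I rule: infinite_finite_induct)
  case (insert i I)
  then show ?case by (simp add: Lp_add[OF assms(1)])
qed (simp_all add: Lp_def)

lemma Lp_similarity:
  assumes A: "similarity_matrix c A" and g: "g \<in> Lp p"
  shows "(\<lambda>x. g (A *v x + z)) \<in> Lp p"
proof -
  have [measurable]: "g \<in> borel_measurable borel" using g by (simp add: Lp_def)
  have "integrable lborel (\<lambda>x. \<bar>g x\<bar> powr p)" using g by (simp add: Lp_def)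
  from integrable_lborel_affine[OF A this, of z] show ?thesis by (simp add: Lp_def)
qed

lemma D1p_L1_loc: "u \<in> D1p p \<Longrightarrow> u \<in> L1_loc"
  by (simp add: D1p_def)

lemma D1p_has_weak_partial:
  assumes "u \<in> D1p p"
  obtains g where "\<And>i. g i \<in> Lp p" "\<And>i. has_weak_partial u i (g i)"
proof -
  have "\<forall>i. \<exists>g. g \<in> Lp p \<and> has_weak_partial u i g" using assms by (auto simp: D1p_def)
  then have "\<exists>g. \<forall>i. g i \<in> Lp p \<and> has_weak_partial u i (g i)" by (rule choice)
  then show ?thesis using that by blast
qed

lemma D1p_weak_gradient:
  assumes "u \<in> D1p p"
  shows "has_weak_partial u i (\<lambda>x. weak_gradient u x $ i)"
proof -
  obtain g where "has_weak_partial u i g" using assms by (auto simp: D1p_def)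
  then show ?thesis unfolding weak_gradient_def by (simp add: someI[of "has_weak_partial u i"])
qed

lemma D1p_continuous:
  fixes u :: "real^'n \<Rightarrow> real"
  assumes "u \<in> D1p p" "real CARD('n) < p"
  shows "continuous_on UNIV u"
proof (rule holder_continuous_imp_continuous_on)
  show "holder_continuous (1 - real CARD('n) / p) u" using assms(1) by (simp add: D1p_def)
  show "0 < 1 - real CARD('n) / p" using assms(2) by (simp add: field_simps)
qed

lemma D1p_linear:
  assumes p: "0 < p" and u: "u \<in> D1p p" and v: "v \<in> D1p p"
  shows "(\<lambda>x. a * u x + b * v x) \<in> D1p p"
proof -
  obtain g where g: "\<And>i. g i \<in> Lp p" "\<And>i. has_weak_partial u i (g i)"
    using D1p_has_weak_partial[OF u] by blast
  obtain h where h: "\<And>i. h i \<in> Lp p" "\<And>i. has_weak_partial v i (h i)"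
    using D1p_has_weak_partial[OF v] by blast
  have "(\<lambda>x. a * g i x + b * h i x) \<in> Lp p"
    and "has_weak_partial (\<lambda>x. a * u x + b * v x) i (\<lambda>x. a * g i x + b * h i x)" for i
    using g h u v p by (auto intro!: Lp_add Lp_cmult has_weak_partial_linear D1p_L1_loc)
  then show ?thesis
    using u v by (auto simp: D1p_def intro!: L1_loc_add L1_loc_cmult holder_continuous_linear)
qed

lemma D1p_similarity:
  assumes p: "0 < p" and A: "similarity_matrix c A" and u: "u \<in> D1p p"
  shows "(\<lambda>x. u (A *v x + z)) \<in> D1p p"
proof -
  obtain g where g: "\<And>i. g i \<in> Lp p" "\<And>i. has_weak_partial u i (g i)"
    using D1p_has_weak_partial[OF u] by blast
  have "(\<lambda>x. \<Sum>i\<in>UNIV. A $ i $ j * g i (A *v x + z)) \<in> Lp p" for j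
    by (intro Lp_sum Lp_cmult Lp_similarity[OF A] g p)
  moreover have "has_weak_partial (\<lambda>x. u (A *v x + z)) j (\<lambda>x. \<Sum>i\<in>UNIV. A $ i $ j * g i (A *v x + z))" for j
    by (intro has_weak_partial_affine[OF A] g D1p_L1_loc[OF u])
  ultimately show ?thesis
    using u by (auto simp: D1p_def intro!: L1_loc_affine[OF A] holder_continuous_similarity[OF A])
qed

lemma AE_weak_gradient_eq:
  assumes u: "u \<in> D1p p" and g: "\<And>i. has_weak_partial u i (\<lambda>x. G x $ i)"
  shows "AE x in lborel. weak_gradient u x = G x"
proof -
  have "AE x in lborel. \<forall>i\<in>UNIV. weak_gradient u x $ i = G x $ i"
    by (intro AE_finite_allI has_weak_partial_unique[OF D1p_weak_gradient[OF u] g]) simp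
  then show ?thesis by eventually_elim (simp add: vec_eq_iff)
qed

lemma AE_weak_gradient_linear:
  assumes "0 < p" "u \<in> D1p p" "v \<in> D1p p"
  shows "AE x in lborel. weak_gradient (\<lambda>x. a * u x + b * v x) x
    = a *\<^sub>R weak_gradient u x + b *\<^sub>R weak_gradient v x"
  using assms by (intro AE_weak_gradient_eq[OF D1p_linear])
    (auto intro!: has_weak_partial_linear D1p_weak_gradient D1p_L1_loc)

lemma AE_weak_gradient_similarity:
  assumes p: "0 < p" and A: "similarity_matrix c A" and u: "u \<in> D1p p"
  shows "AE x in lborel. weak_gradient (\<lambda>x. u (A *v x + z)) x
    = transpose A *v weak_gradient u (A *v x + z)"
  using has_weak_partial_affine[OF A D1p_L1_loc[OF u] D1p_weak_gradient[OF u]]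
  by (intro AE_weak_gradient_eq[OF D1p_similarity[OF p A u]])
    (simp add: matrix_vector_mult_def transpose_def)

lemma borel_measurable_weak_gradient:
  assumes "u \<in> D1p p"
  shows "weak_gradient u \<in> borel_measurable borel"
  unfolding borel_measurable_euclidean_space[of "weak_gradient u"]
proof
  fix b :: "real^'a" assume "b \<in> Basis"
  then obtain i where "b = axis i 1" by (auto simp: Basis_vec_def)
  then show "(\<lambda>x. weak_gradient u x \<bullet> b) \<in> borel_measurable borel"
    using L1_loc_measurable[OF has_weak_partial_L1_loc[OF D1p_weak_gradient[OF assms]], of i]
    by (simp add: inner_axis)
qed

lemma norm_Du_nonneg: "0 \<le> norm_Du p u"
  by (simp add: norm_Du_def)

lemma norm_Du_powr:
  assumes "0 < p"
  shows "norm_Du p u powr p = (LINT x|lborel. norm (weak_gradient u x) powr p)"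
  using assms by (simp add: norm_Du_def powr_powr integral_nonneg_AE)

text \<open>The integral of a function that is not integrable is 0 by convention, so a positive
  value certifies integrability.\<close>

lemma integrable_norm_Du:
  assumes "norm_Du p u > 0"
  shows "integrable lborel (\<lambda>x. norm (weak_gradient u x) powr p)"
  using assms not_integrable_integral_eq unfolding norm_Du_def by fastforce

lemma norm_Du_cmult:
  assumes p: "0 < p" and u: "u \<in> D1p p"
  shows "norm_Du p (\<lambda>x. a * u x) = \<bar>a\<bar> * norm_Du p u"
proof -
  have D: "AE x in lborel. weak_gradient (\<lambda>x. a * u x) x = a *\<^sub>R weak_gradient u x"
    using AE_weak_gradient_linear[OF p u u, of a 0] by simp
  have au: "(\<lambda>x. a * u x) \<in> D1p p" using D1p_linear[OF p u u, of a 0] by simp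
  note [measurable] = borel_measurable_weak_gradient[OF u] borel_measurable_weak_gradient[OF au]
  have "(LINT x|lborel. norm (weak_gradient (\<lambda>x. a * u x) x) powr p)
      = (LINT x|lborel. \<bar>a\<bar> powr p * norm (weak_gradient u x) powr p)"
    by (rule integral_cong_AE) (use D in \<open>auto elim!: eventually_mono simp: powr_mult\<close>)
  then show ?thesis
    using p by (simp add: norm_Du_def powr_mult powr_powr integral_nonneg_AE)
qed

text \<open>The gradient of the composition is \<open>transpose A\<close> applied to the transported
  gradient, which contributes \<open>c powr p\<close>; the Jacobian contributes
  \<open>c powr (- n)\<close>. The p-th root of the product is the factor that the denominator also
  acquires.\<close>

lemma norm_Du_similarity:
  fixes u :: "real^'n \<Rightarrow> real"
  assumes p: "0 < p" and A: "similarity_matrix c A" and u: "u \<in> D1p p"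
  shows "norm_Du p (\<lambda>x. u (A *v x + z)) = c powr (1 - real CARD('n) / p) * norm_Du p u"
proof -
  let ?w = "\<lambda>x. u (A *v x + z)" and ?G = "\<lambda>x. norm (weak_gradient u x) powr p"
  have c: "0 < c" by (rule similarity_matrix_pos[OF A])
  note [measurable] = borel_measurable_weak_gradient[OF u]
    borel_measurable_weak_gradient[OF D1p_similarity[OF p A u, of z]]
  have "(LINT x|lborel. norm (weak_gradient ?w x) powr p) = (LINT x|lborel. c powr p * ?G (A *v x + z))"
    by (rule integral_cong_AE)
      (use AE_weak_gradient_similarity[OF p A u, of z] c
        norm_similarity_matrix[OF similarity_matrix_transpose[OF A]]
        in \<open>auto elim!: eventually_mono simp: powr_mult\<close>)
  also have "\<dots> = c powr p * (LINT x|lborel. ?G (A *v x + z))" by simp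
  also have "(LINT x|lborel. ?G (A *v x + z)) = c powr (- real CARD('n)) * (LINT x|lborel. ?G x)"
    using c by (subst integral_lborel_affine[OF A, of ?G z])
      (auto simp: powr_minus powr_realpow)
  finally have "(LINT x|lborel. norm (weak_gradient ?w x) powr p)
      = c powr (p - real CARD('n)) * (LINT x|lborel. ?G x)"
    by (simp add: powr_diff powr_minus field_simps)
  then show ?thesis
    using p c by (simp add: norm_Du_def powr_mult powr_powr integral_nonneg_AE diff_divide_distrib)
qed

section \<open>The Morrey seminorm and the Morrey constant\<close>

lemma push_forward_id: "push_forward (\<lambda>x. x) \<rho> = \<rho>"
  by (simp add: push_forward_def fun_eq_iff)

lemma id_in_similarities: "(\<lambda>x. x) \<in> (similarities :: (real^'n \<Rightarrow> real^'n) set)"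
  unfolding similarities_def
  by (intro CollectI exI[of _ 1] exI[of _ "mat 1"] exI[of _ 0]) (simp add: orthogonal_matrix_id)

lemma morrey_seminorm_ge:
  "ennreal (\<bar>signed_integral \<rho> u\<bar> / morrey_denominator p \<rho>) \<le> morrey_seminorm p \<rho> u"
proof -
  have "\<rho> \<in> {push_forward S \<rho> |S. S \<in> similarities}"
    using id_in_similarities push_forward_id[of \<rho>] by force
  then show ?thesis unfolding morrey_seminorm_def by (rule SUP_upper)
qed

text \<open>The infimum is itself an admissible constant: dividing by a positive gradient norm
  exhibits the quotient as a lower bound of all admissible constants.\<close>

lemma morrey_seminorm_le_constant:
  assumes u: "u \<in> D1p p" and fin: "morrey_constant p \<rho> < \<infinity>"
  shows "morrey_seminorm p \<rho> u \<le> morrey_constant p \<rho> * ennreal (norm_Du p u)"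
proof (cases "norm_Du p u = 0")
  case True
  \<comment> \<open>Division is impossible for gradient norm 0. The infimum of the empty set is
    infinite, so finiteness yields some admissible \<open>C\<close>, and its bound is already
    0.\<close>
  have "{C. \<forall>u \<in> D1p p. morrey_seminorm p \<rho> u \<le> C * ennreal (norm_Du p u)} \<noteq> {}"
    using fin unfolding morrey_constant_def by force
  then obtain C where "morrey_seminorm p \<rho> u \<le> C * ennreal (norm_Du p u)" using u by blast
  then show ?thesis by (simp add: True)
next
  case False
  then have pos: "norm_Du p u > 0" using norm_Du_nonneg[of p u] by simp
  have "morrey_seminorm p \<rho> u / ennreal (norm_Du p u) \<le> morrey_constant p \<rho>"
    unfolding morrey_constant_def
    using u pos by (intro Inf_greatest) (simp add: divide_le_posI_ennreal mult.commute)
  then have "morrey_seminorm p \<rho> u / ennreal (norm_Du p u) * ennreal (norm_Du p u)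
      \<le> morrey_constant p \<rho> * ennreal (norm_Du p u)"
    by (rule mult_right_mono) simp
  then show ?thesis
    using pos by (simp add: ennreal_divide_times ennreal_times_divide mult_divide_eq_ennreal)
qed

text \<open>A product in \<open>ennreal\<close> with a finite positive value has no zero factor, and
  then no infinite one either. This is the source of the finiteness of the Morrey constant.\<close>

lemma extremal_norm_Du:
  assumes u: "extremal p \<rho> u" and r: "morrey_seminorm p \<rho> u = ennreal r" "r > 0"
  shows "morrey_constant p \<rho> < \<infinity>" "0 < norm_Du p u"
    "enn2real (morrey_constant p \<rho>) * norm_Du p u = r"
proof -
  have eq: "morrey_constant p \<rho> * ennreal (norm_Du p u) = ennreal r"
    using u r(1) by (simp add: extremal_def)
  show pos: "0 < norm_Du p u"
    using eq r(2) norm_Du_nonneg[of p u] by (cases "norm_Du p u = 0") auto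
  show fin: "morrey_constant p \<rho> < \<infinity>"
    using eq pos by (auto simp: less_top[symmetric] ennreal_top_mult)
  show "enn2real (morrey_constant p \<rho>) * norm_Du p u = r"
    using arg_cong[OF eq, of enn2real] pos r(2) by (simp add: enn2real_mult)
qed


subsection \<open>Uniqueness of extremals\<close>

text \<open>Allows the chosen representative of an almost everywhere vanishing gradient to be
  replaced by the function 0 itself.\<close>

lemma has_weak_partial_AE_cong:
  assumes g: "has_weak_partial u i g" and h: "h \<in> L1_loc" and eq: "AE x in lborel. g x = h x"
  shows "has_weak_partial u i h"
  unfolding has_weak_partial_def
proof (intro conjI allI impI h)
  fix \<phi> :: "real^'a \<Rightarrow> real" assume \<phi>: "test_function \<phi>"
  have "(LINT x|lborel. g x * \<phi> x) = (LINT x|lborel. h x * \<phi> x)"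
  proof (rule integral_cong_AE)
    show "(\<lambda>x. g x * \<phi> x) \<in> borel_measurable lborel" "(\<lambda>x. h x * \<phi> x) \<in> borel_measurable lborel"
      using integrable_L1_loc_mult_test_function[OF has_weak_partial_L1_loc[OF g] \<phi>]
        integrable_L1_loc_mult_test_function[OF h \<phi>] by (auto dest: borel_measurable_integrable)
    show "AE x in lborel. g x * \<phi> x = h x * \<phi> x"
      using eq by eventually_elim simp
  qed
  then show "(LINT x|lborel. u x * partial_deriv i \<phi> x) = - (LINT x|lborel. h x * \<phi> x)"
    using has_weak_partial_integral[OF g \<phi>] by simp
qed

lemma norm_Du_midpoint_eq_imp:
  fixes f g :: "real^'n \<Rightarrow> real"
  assumes p: "real CARD('n) < p" and f: "f \<in> D1p p" and g: "g \<in> D1p p" and K: "0 < K"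
    and Df: "norm_Du p f = K" and Dg: "norm_Du p g = K"
    and mid: "K \<le> norm_Du p (\<lambda>x. (1 / 2) * f x + (1 / 2) * g x)"
  shows "f x - g x = f 0 - g 0"
proof -
  let ?z = "\<lambda>x. (1 / 2) * f x + (1 / 2) * g x" and ?W = "\<lambda>x. 1 * f x + (- 1) * g x"
  \<comment> \<open>Strict convexity needs \<open>p > 1\<close>, which follows from
    \<open>p > n\<close> because the dimension is at least 1.\<close>
  have "1 \<le> real CARD('n)" by (simp add: Suc_leI)
  then have p1: "1 < p" using p by linarith
  then have p0: "0 < p" by simp
  have W: "?W \<in> D1p p" and z: "?z \<in> D1p p"
    by (rule D1p_linear[OF p0 f g])+
  note [measurable] = borel_measurable_weak_gradient[OF f] borel_measurable_weak_gradient[OF g]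
    borel_measurable_weak_gradient[OF z]
  have Dz: "AE x in lborel. norm (weak_gradient ?z x) powr p
      = norm ((1 / 2) *\<^sub>R (weak_gradient f x + weak_gradient g x)) powr p"
    using AE_weak_gradient_linear[OF p0 f g, of "1 / 2" "1 / 2"]
    by eventually_elim (simp add: scaleR_right_distrib)
  have "AE x in lborel. weak_gradient f x = weak_gradient g x"
  proof (rule Lp_norm_strictly_convex[OF p1])
    show "integrable lborel (\<lambda>x. norm (weak_gradient f x) powr p)"
      "integrable lborel (\<lambda>x. norm (weak_gradient g x) powr p)"
      using Df Dg K by (simp_all add: integrable_norm_Du)
    show "(LINT x|lborel. norm (weak_gradient f x) powr p) \<le> K powr p"
      "(LINT x|lborel. norm (weak_gradient g x) powr p) \<le> K powr p"
      using norm_Du_powr[OF p0, of f] norm_Du_powr[OF p0, of g] Df Dg by simp_all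
    \<comment> \<open>The lower bound \<open>mid\<close> serves twice: being positive it gives
      integrability here, and it supplies the inequality against convexity below.\<close>
    have "integrable lborel (\<lambda>x. norm (weak_gradient ?z x) powr p)"
      using mid K by (intro integrable_norm_Du) simp
    then show "integrable lborel (\<lambda>x. norm ((1 / 2) *\<^sub>R (weak_gradient f x + weak_gradient g x)) powr p)"
      by (rule integrable_cong_AE_imp) (use Dz in \<open>auto simp: eq_commute\<close>)
    have "K powr p \<le> (LINT x|lborel. norm (weak_gradient ?z x) powr p)"
      unfolding norm_Du_powr[OF p0, symmetric] using mid K p0 by (intro powr_mono2) auto
    also have "\<dots> = (LINT x|lborel. norm ((1 / 2) *\<^sub>R (weak_gradient f x + weak_gradient g x)) powr p)"
      by (rule integral_cong_AE[OF _ _ Dz]) measurable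
    finally show "K powr p \<le> (LINT x|lborel. norm ((1 / 2) *\<^sub>R (weak_gradient f x + weak_gradient g x)) powr p)" .
  qed
  with AE_weak_gradient_linear[OF p0 f g, of 1 "- 1"]
  have DW: "AE x in lborel. weak_gradient ?W x = 0"
    by eventually_elim simp
  have "has_weak_partial ?W i (\<lambda>x. 0)" for i
  proof (rule has_weak_partial_AE_cong[OF D1p_weak_gradient[OF W]])
    show "AE x in lborel. weak_gradient ?W x $ i = 0"
      using DW by eventually_elim simp
  qed (simp add: L1_loc_continuous)
  from constant_if_weak_partials_zero[OF D1p_continuous[OF W p] this, of x]
  show ?thesis by simp
qed

section \<open>Signed integrals under similarities and the comparison argument\<close>

lemma signed_integral_similarity:
  fixes f :: "real^'n \<Rightarrow> 'b::{banach, second_countable_topology}"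
  assumes \<rho>: "signed_borel_measure \<rho>" and A: "similarity_matrix c A" and f: "f \<in> borel_measurable borel"
  shows "signed_integral (push_forward (\<lambda>y. A *v y + z) \<rho>) f = signed_integral \<rho> (\<lambda>y. f (A *v y + z))"
proof -
  obtain B where B: "B ** A = mat 1"
    using invertible_similarity_matrix[OF A] by (auto simp: invertible_def)
  show ?thesis
  proof (rule signed_integral_push_forward[OF \<rho> _ _ _ f])
    show "(\<lambda>x. B *v x + - (B *v z)) \<in> borel_measurable borel"
      by (rule borel_measurable_affine)
    show "B *v (A *v x + z) + - (B *v z) = x" for x
      by (simp add: matrix_vector_right_distrib matrix_vector_mul_assoc B)
  qed simp
qed

text \<open>The first moment is mapped by the linear part alone, because the translation contributes
  \<open>\<rho> UNIV\<close> times \<open>z\<close>, which is 0; the linear part scales norms by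
  \<open>c\<close>.\<close>

lemma morrey_denominator_similarity:
  fixes \<rho> :: "(real^'n) set \<Rightarrow> real"
  assumes \<rho>: "admissible \<rho>" and A: "similarity_matrix c A"
  shows "morrey_denominator p (push_forward (\<lambda>y. A *v y + z) \<rho>)
    = c powr (1 - real CARD('n) / p) * morrey_denominator p \<rho>"
proof -
  have m: "signed_borel_measure \<rho>" "compact (signed_support \<rho>)" "\<rho> UNIV = 0"
    using \<rho> by (simp_all add: admissible_def)
  note lin = matrix_vector_mul_bounded_linear[of A]
  have "signed_integral (push_forward (\<lambda>y. A *v y + z) \<rho>) (\<lambda>x. x)
      = signed_integral \<rho> (\<lambda>y. A *v y) + signed_integral \<rho> (\<lambda>y. z)"
    using signed_integral_similarity[OF m(1) A, of "\<lambda>x. x" z]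
      signed_integral_add[OF m(1,2) linear_continuous_on[OF lin] continuous_on_const] by simp
  also have "\<dots> = A *v signed_integral \<rho> (\<lambda>y. y)"
    using signed_integral_bounded_linear[OF m(1,2) continuous_on_id lin] signed_integral_const[OF m(1), of z] m(3)
    by simp
  finally show ?thesis
    using similarity_matrix_pos[OF A]
    by (simp add: morrey_denominator_def norm_similarity_matrix[OF A] powr_mult)
qed

theorem proposition4p1:
  fixes p :: real
    and \<rho> \<mu> :: "(real^'n) set \<Rightarrow> real"
    and S :: "real^'n \<Rightarrow> real^'n"
    and u v :: "real^'n \<Rightarrow> real"
  assumes "real CARD('n) < p"
    and "admissible \<rho>"
    and "S \<in> similarities"
    and "\<mu> = push_forward S \<rho>"
    and "extremal p \<rho> u"
    and "extremal p \<rho> v"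
    and "morrey_seminorm p \<rho> u = ennreal (signed_integral \<mu> u / morrey_denominator p \<mu>)"
    and "signed_integral \<mu> u / morrey_denominator p \<mu> > 0"
    and "morrey_seminorm p \<rho> v = ennreal (signed_integral \<rho> v / morrey_denominator p \<rho>)"
    and "signed_integral \<rho> v / morrey_denominator p \<rho> > 0"
  shows "\<forall>y. v y = signed_integral \<rho> v / signed_integral \<mu> u * (u (S y) - u (S 0)) + v 0"
proof
  fix y
  note p = assms(1)
  have p0: "0 < p" using p by (rule le_less_trans[rotated]) simp
  obtain c Q z where "c > 0" "orthogonal_matrix Q" and S_eq: "S = (\<lambda>y. c *\<^sub>R (Q *v y) + z)"
    using assms(3) by (auto simp: similarities_def)
  then have A: "similarity_matrix c (c *\<^sub>R Q)" and S: "S = (\<lambda>y. (c *\<^sub>R Q) *v y + z)"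
    by (auto simp: similarity_matrix_def simp flip: scaleR_matrix_vector_assoc)
  have m: "signed_borel_measure \<rho>" "compact (signed_support \<rho>)"
    using assms(2) by (simp_all add: admissible_def)
  have uD: "u \<in> D1p p" and vD: "v \<in> D1p p"
    using assms(5,6) by (simp_all add: extremal_def)
  let ?w = "\<lambda>x. u (S x)"
  have wD: "?w \<in> D1p p" unfolding S by (rule D1p_similarity[OF p0 A uD])
  define U V d s where "U = signed_integral \<mu> u" and "V = signed_integral \<rho> v"
    and "d = morrey_denominator p \<rho>" and "s = c powr (1 - real CARD('n) / p)"
  have s: "s > 0" using \<open>c > 0\<close> by (simp add: s_def)
  \<comment> \<open>Admissibility enters through the nonvanishing first moment of \<rho>.\<close>
  have d: "d > 0" using assms(2) by (simp add: d_def morrey_denominator_def admissible_def)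
  have d\<mu>: "morrey_denominator p \<mu> = s * d"
    unfolding assms(4) S d_def s_def by (rule morrey_denominator_similarity[OF assms(2) A])
  have Uw: "U = signed_integral \<rho> ?w"
    unfolding U_def assms(4) S
    by (rule signed_integral_similarity[OF m(1) A borel_measurable_continuous_onI[OF D1p_continuous[OF uD p]]])
  have U: "U > 0" and V: "V > 0"
    using assms(8,10) d mult_pos_pos[OF s d]
    unfolding d\<mu> U_def[symmetric] V_def[symmetric] d_def[symmetric]
    by (auto simp: zero_less_divide_iff dest: less_asym)
  define C where "C = enn2real (morrey_constant p \<rho>)"
  note exu = extremal_norm_Du[OF assms(5,7,8)] and exv = extremal_norm_Du[OF assms(6,9,10)]
  have Cu: "C * norm_Du p u = U / (s * d)" and Cv: "C * norm_Du p v = V / d"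
    using exu(3) exv(3) by (simp_all add: C_def U_def V_def d\<mu> d_def)
  have C: "C > 0"
    using Cv V d exv(2) by (metis divide_pos_pos zero_less_mult_pos2)
  let ?f = "\<lambda>x. (1 / V) * v x" and ?g = "\<lambda>x. (1 / U) * ?w x"
  let ?z = "\<lambda>x. (1 / 2) * ?f x + (1 / 2) * ?g x"
  have f: "?f \<in> D1p p" and g: "?g \<in> D1p p"
    using D1p_linear[OF p0 vD vD, of "1 / V" 0] D1p_linear[OF p0 wD wD, of "1 / U" 0] by simp_all
  have zD: "?z \<in> D1p p" by (rule D1p_linear[OF p0 f g])
  have Df: "norm_Du p ?f = 1 / (C * d)"
    unfolding norm_Du_cmult[OF p0 vD] using Cv C V d by (simp add: field_simps)
  have "norm_Du p ?w = s * norm_Du p u"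
    unfolding S s_def by (rule norm_Du_similarity[OF p0 A uD])
  \<comment> \<open>The scale cancels: the norm of \<open>?w\<close> is
    \<open>s * norm_Du p u\<close>, and \<open>C * norm_Du p u = U / (s * d)\<close>, so the norm of
    \<open>?w\<close> is \<open>U / (C * d)\<close>.\<close>
  then have Dg: "norm_Du p ?g = 1 / (C * d)"
    unfolding norm_Du_cmult[OF p0 wD] using Cu C U d s by (simp add: field_simps)
  have "signed_integral \<rho> ?z = signed_integral \<rho> (\<lambda>x. (1 / 2) * ?f x) + signed_integral \<rho> (\<lambda>x. (1 / 2) * ?g x)"
    by (intro signed_integral_add m continuous_on_mult_left D1p_continuous[OF f p] D1p_continuous[OF g p])
  also have "\<dots> = 1"
    unfolding signed_integral_cmult V_def[symmetric] Uw[symmetric] using U V by simp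
  finally have "signed_integral \<rho> ?z = 1" .
  \<comment> \<open>The identity is a similarity, so \<rho> itself competes in the supremum, with
    numerator 1.\<close>
  then have "ennreal (1 / d) \<le> morrey_seminorm p \<rho> ?z"
    using morrey_seminorm_ge[of \<rho> ?z p] by (simp add: d_def)
  also have "\<dots> \<le> morrey_constant p \<rho> * ennreal (norm_Du p ?z)"
    by (rule morrey_seminorm_le_constant[OF zD exv(1)])
  also have "\<dots> = ennreal (C * norm_Du p ?z)"
    using exv(1) C by (simp add: C_def ennreal_mult norm_Du_nonneg)
  finally have "1 / d \<le> C * norm_Du p ?z"
    using C by (simp add: norm_Du_nonneg)
  then have mid: "1 / (C * d) \<le> norm_Du p ?z"
    using C d by (simp add: field_simps)
  \<comment> \<open>Multiplying this identity by \<open>V\<close> gives the claim; the constant of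
    integration is read off at 0.\<close>
  have "?f y - ?g y = ?f 0 - ?g 0"
    by (rule norm_Du_midpoint_eq_imp[OF p f g _ Df Dg mid]) (use C d in simp)
  then show "v y = signed_integral \<rho> v / signed_integral \<mu> u * (u (S y) - u (S 0)) + v 0"
    using U V by (simp add: field_simps flip: U_def V_def)
qed

end
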